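(* Let $D$ be a convex domain in $\mathbb{C}$ and let $\ell\in\mathbb{N}$. (1) The map $t^{-\ell}T\colon \mathcal{S}ol(D\times D)_{\ell}\to\mathcal{O}(D)$ is a bijection. (2) The inverse of $t^{-\ell}T$ is given, up to the scalar below, by the integral operator $\Psi_\ell$; namely, $\Psi_{\ell}\colon\mathcal{O}(D)\to\mathcal{S}ol(D\times D)_{\ell}$ is a bijection and $$t^{-\ell}T\circ\Psi_{\ell}=\frac{2^{2\ell+1}}{2\ell+1}\,\mathrm{id}_{\mathcal{O}(D)}.$$
   Context: $\mathbb{N}=\{0,1,2,\dots\}$; $\mathcal{O}(\cdot)$ denotes the space of holomorphic functions. Let $$P:=(\zeta_1-\zeta_2)^2\frac{\partial^2}{\partial\zeta_1\partial\zeta_2}-(\zeta_1-\zeta_2)\left(\frac{\partial}{\partial\zeta_1}-\frac{\partial}{\partial\zeta_2}\right),\qquad \mathcal{S}ol(D\times D)_{\ell}:=\{f\in\mathcal{O}(D\times D):\ Pf=-\ell(\ell+1)f\}.$$ For $g\in\mathcal{O}(D)$ put $$(\Psi_{\ell}g)(\zeta_1,\zeta_2):=(\zeta_1-\zeta_2)^{\ell}\int_{-1}^{1}g\!\left(\frac{(\zeta_2-\zeta_1)v+(\zeta_1+\zeta_2)}{2}\right)(1-v^2)^{\ell}\,dv .$$ For $z\in D$, $d(z,\partial D)$ is the distance from $z$ to the boundary of $D$ ($=\infty$ if $D=\mathbb{C}$), and $U_D:=\{(z,t)\in D\times\mathbb{C}:\ 2|t|<d(z,\partial D)\}$. For $f\in\mathcal{O}(D\times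 D)$ and $(z,t)\in U_D$ define $$(Tf)(z,t):=\frac{1}{(2\pi\sqrt{-1})^2}\oint_{C_1}\oint_{C_2}\frac{f(\zeta_1,\zeta_2)}{(\zeta_1-z)(\zeta_2-z)+t(\zeta_1-\zeta_2)}\,d\zeta_1\,d\zeta_2,$$ where $C_1=C_2$ is the positively oriented circle centred at $z$ of radius $r$ with $2|t|<r<d(z,\partial D)$. For $f\in\mathcal{S}ol(D\times D)_\ell$ the function $(Tf)(z,t)$ has the form $t^{\ell}\varphi(z)$ with a unique $\varphi\in\mathcal{O}(D)$; one writes $t^{-\ell}Tf:=\varphi$. *)

theory Defs
  imports "HOL-Complex_Analysis.Complex_Analysis"
begin

text \<open>
  Holomorphy in two variables is complex Frechet differentiability.  The spaces \<open>\<O>(D)\<close> and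
  \<open>Sol(D \<times> D)\<^sub>l\<close> are sets of functions defined on \<open>D\<close> resp. \<open>D \<times> D\<close> only; such functions are
  represented as extensional functions, so that equality means equality on the domain.
\<close>

definition holomorphic2_on :: "(complex \<times> complex \<Rightarrow> complex) \<Rightarrow> (complex \<times> complex) set \<Rightarrow> bool"
    (infixl \<open>holomorphic2'_on\<close> 50) where
  "f holomorphic2_on S \<longleftrightarrow>
     (\<forall>p\<in>S. \<exists>a b. (f has_derivative (\<lambda>h. a * fst h + b * snd h)) (at p within S))"

definition Hol :: "complex set \<Rightarrow> (complex \<Rightarrow> complex) set" where
  "Hol D = {g \<in> extensional D. g holomorphic_on D}"

definition Hol2 :: "(complex \<times> complex) set \<Rightarrow> (complex \<times> complex \<Rightarrow> complex) set" where
  "Hol2 S = {f \<in> extensional S. f holomorphic2_on S}"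

definition pd1 :: "(complex \<times> complex \<Rightarrow> complex) \<Rightarrow> complex \<times> complex \<Rightarrow> complex" where
  "pd1 f = (\<lambda>(x, y). deriv (\<lambda>x'. f (x', y)) x)"

definition pd2 :: "(complex \<times> complex \<Rightarrow> complex) \<Rightarrow> complex \<times> complex \<Rightarrow> complex" where
  "pd2 f = (\<lambda>(x, y). deriv (\<lambda>y'. f (x, y')) y)"

definition P_op :: "(complex \<times> complex \<Rightarrow> complex) \<Rightarrow> complex \<times> complex \<Rightarrow> complex" where
  "P_op f = (\<lambda>(x, y). (x - y)\<^sup>2 * pd1 (pd2 f) (x, y) - (x - y) * (pd1 f (x, y) - pd2 f (x, y)))"

definition Sol :: "complex set \<Rightarrow> nat \<Rightarrow> (complex \<times> complex \<Rightarrow> complex) set" where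
  "Sol D l = {f \<in> Hol2 (D \<times> D). \<forall>p \<in> D \<times> D. P_op f p = - (of_nat l * (of_nat l + 1)) * f p}"

definition Psi :: "complex set \<Rightarrow> nat \<Rightarrow> (complex \<Rightarrow> complex) \<Rightarrow> complex \<times> complex \<Rightarrow> complex" where
  "Psi D l g = (\<lambda>(x, y) \<in> D \<times> D.
     (x - y) ^ l *
     integral {-1..1} (\<lambda>v::real. g (((y - x) * of_real v + (x + y)) / 2) * of_real ((1 - v\<^sup>2) ^ l)))"

text \<open>The infimum over the empty set is \<open>\<infinity>\<close>, which is the convention for \<open>D = \<complex>\<close>.\<close>

definition bdry_dist :: "complex set \<Rightarrow> complex \<Rightarrow> ereal" where
  "bdry_dist D z = (INF w\<in>frontier D. ereal (dist z w))"

definition U_dom :: "complex set \<Rightarrow> (complex \<times> complex) set" where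
  "U_dom D = {(z, t). z \<in> D \<and> ereal (2 * norm t) < bdry_dist D z}"

definition T_circ :: "real \<Rightarrow> (complex \<times> complex \<Rightarrow> complex) \<Rightarrow> complex \<times> complex \<Rightarrow> complex" where
  "T_circ r f = (\<lambda>(z, t). 1 / (2 * of_real pi * \<i>)\<^sup>2 *
     contour_integral (circlepath z r) (\<lambda>x.
       contour_integral (circlepath z r) (\<lambda>y.
         f (x, y) / ((x - z) * (y - z) + t * (x - y)))))"

text \<open>The common value of the double contour integral over all admissible radii.\<close>

definition T_op :: "complex set \<Rightarrow> (complex \<times> complex \<Rightarrow> complex) \<Rightarrow> complex \<times> complex \<Rightarrow> complex" where
  "T_op D f = (\<lambda>(z, t). THE c. \<forall>r. 2 * norm t < r \<and> ereal r < bdry_dist D z \<longrightarrow> T_circ r f (z, t) = c)"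

text \<open>\<open>t\<^sup>-\<^sup>lTf\<close> is the \<open>\<phi>\<close> with \<open>(Tf)(z,t) = t\<^sup>l\<phi>(z)\<close>; the identity is required on all of \<open>U\<^sub>D\<close>, so
  nothing is ever divided by \<open>t = 0\<close>, and \<open>0\<^sup>0 = 1\<close> for \<open>l = 0\<close>.\<close>

definition tT :: "complex set \<Rightarrow> nat \<Rightarrow> (complex \<times> complex \<Rightarrow> complex) \<Rightarrow> complex \<Rightarrow> complex" where
  "tT D l f = (THE \<phi>. \<phi> \<in> Hol D \<and> (\<forall>(z, t) \<in> U_dom D. T_op D f (z, t) = t ^ l * \<phi> z))"

end

theory Submission
  imports Defs
begin

text \<open>
  In the coordinates \<open>m = (\<zeta>\<^sub>1 + \<zeta>\<^sub>2) / 2\<close>, \<open>\<tau> = (\<zeta>\<^sub>1 - \<zeta>\<^sub>2) / 2\<close> the equation reads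
  \<open>\<tau>\<^sup>2 (f\<^sub>m\<^sub>m - f\<^sub>\<tau>\<^sub>\<tau>) - 2 \<tau> f\<^sub>\<tau> + l (l + 1) f = 0\<close>.  Comparing Taylor coefficients in \<open>\<tau>\<close> shows that a
  solution is determined by its \<open>l\<close>-th coefficient, an arbitrary holomorphic function of \<open>m\<close>, and
  \<open>\<Psi>\<^sub>l g\<close>, a solution by partial integration, has \<open>l\<close>-th coefficient a nonzero multiple of \<open>g\<close>.
  Hence \<open>\<Psi>\<^sub>l\<close> is onto.  As a function of \<open>\<zeta>\<^sub>2\<close> the kernel of \<open>T\<close> has one simple pole inside the
  circle, so \<open>T\<close> reduces to a single integral; for \<open>g = (w - z)\<^sup>n\<close> the latter is a binomial sum
  in which Beta integrals cancel the binomial coefficients of the residues, and the Taylor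
  expansion of \<open>g\<close> at \<open>z\<close> gives \<open>T \<Psi>\<^sub>l g\<close>.
\<close>

section \<open>Holomorphic functions of two variables\<close>

text \<open>\<open>T\<close> is never analysed on a general solution: that its value has the form
  t^l \<phi>(z) is obtained only through the representation of every solution as some
  \<open>Psi D l g\<close>. Bijectivity of \<open>tT\<close> is then formal, because its composite
  with the surjective \<open>Psi\<close> is multiplication by a nonzero scalar. That scalar is the
  product of the Beta integral 2 * 4^l (l!)^2 / (2l+1)! and the residue (2l)! / (l!)^2. Convexity
  enters twice: chords between points of D must stay in D for \<open>Psi\<close> to make sense, and
  the slices with fixed midpoint must be connected, so that a Taylor series vanishing at the
  diagonal forces the solution to vanish. The initial obstacle is that holomorphy is pointwise
  Frechet differentiability, while P contains iterated partial derivatives. Their continuity,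
  holomorphy and symmetry are all drawn from Cauchy integrals over a circle in one variable, with
  the other variable as a parameter.\<close>

lemma open_prod_cball:
  fixes S :: "('a::metric_space \<times> 'b::metric_space) set"
  assumes "open S" "(x, y) \<in> S"
  obtains r where "r > 0" "cball x r \<times> cball y r \<subseteq> S"
proof -
  from open_prod_elim[OF assms] obtain A B where AB: "open A" "open B" "x \<in> A" "y \<in> B" "A \<times> B \<subseteq> S"
    by (metis mem_Sigma_iff)
  obtain r1 where r1: "r1 > 0" "cball x r1 \<subseteq> A" using AB open_contains_cball by metis
  obtain r2 where r2: "r2 > 0" "cball y r2 \<subseteq> B" using AB open_contains_cball by metis
  show thesis
  proof
    show "min r1 r2 > 0" using r1 r2 by simp
    show "cball x (min r1 r2) \<times> cball y (min r1 r2) \<subseteq> S" using r1 r2 AB by fastforce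
  qed
qed

section \<open>Partial derivatives as Cauchy integrals\<close>

lemma pd2_conv_pd1: "pd2 f = pd1 (f \<circ> prod.swap) \<circ> prod.swap"
  by (auto simp: fun_eq_iff pd1_def pd2_def)

text \<open>The integrand is Cauchy's formula for the derivative, pulled back to [0, 1]; the factor
  1/(2 pi i) has been absorbed into the velocity of the circle. Points in the open ball never meet
  the circle, so the denominator does not vanish.\<close>

lemma continuous_on_pd1_Cauchy_kernel:
  assumes "continuous_on (sphere x0 r \<times> V) f" "0 < r"
  shows "continuous_on ((ball x0 r \<times> V) \<times> cbox 0 1)
    (\<lambda>((x, y), t). f (circlepath x0 r t, y) / (circlepath x0 r t - x)\<^sup>2 * (of_real r * exp (2 * of_real pi * \<i> * t)))"
proof -
  have "circlepath x0 r t \<in> sphere x0 r" for t :: real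
    using assms(2) by (simp add: circlepath_def part_circlepath_def dist_norm norm_mult)
  moreover have "continuous_on ((ball x0 r \<times> V) \<times> cbox 0 1) (\<lambda>((x, y), t). circlepath x0 r t)"
    unfolding circlepath_def part_circlepath_def split_beta linepath_def by (intro continuous_intros)
  moreover have "circlepath x0 r t \<noteq> x" if "x \<in> ball x0 r" for x and t :: real
    using calculation(1)[of t] that by auto
  ultimately show ?thesis
    unfolding split_beta
    by (intro continuous_intros continuous_on_compose2[OF assms(1)]) (auto simp: split_beta)
qed

text \<open>Cauchy's formula trades the derivative in x for an integral of f itself, so regularity
  in y and joint continuity can be read off under the integral sign.\<close>

lemma pd1_eq_integral:
  assumes "continuous_on S f" "\<And>x y. (x, y) \<in> S \<Longrightarrow> (\<lambda>x'. f (x', y)) field_differentiable (at x)"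
    and sub: "cball x0 r \<times> V \<subseteq> S" and "0 < r" "x \<in> ball x0 r" "y \<in> V"
  shows "((\<lambda>x'. f (x', y)) has_field_derivative pd1 f (x, y)) (at x)" (is ?th1)
    and "pd1 f (x, y) = integral (cbox 0 1) (\<lambda>t. f (circlepath x0 r t, y) / (circlepath x0 r t - x)\<^sup>2
          * (of_real r * exp (2 * of_real pi * \<i> * t)))" (is ?th2)
proof -
  have "(\<lambda>x'. f (x', y)) field_differentiable (at x)"
    using sub assms(5,6) by (intro assms(2)) auto
  then show ?th1 by (simp add: pd1_def field_differentiable_derivI)
  have hol: "(\<lambda>x'. f (x', y)) holomorphic_on cball x0 r"
    unfolding holomorphic_on_def using assms(2) sub \<open>y \<in> V\<close>
    by (meson SigmaI field_differentiable_at_within subsetD)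
  have "((\<lambda>x'. f (x', y)) has_field_derivative
     (1 / (2 * of_real pi * \<i>) * contour_integral (circlepath x0 r) (\<lambda>u. f (u, y) / (u - x)\<^sup>2))) (at x)"
    using hol by (intro Cauchy_derivative_integral_circlepath assms)
       (auto intro: holomorphic_on_imp_continuous_on holomorphic_on_subset)
  then have "pd1 f (x, y) = 1 / (2 * of_real pi * \<i>) * contour_integral (circlepath x0 r) (\<lambda>u. f (u, y) / (u - x)\<^sup>2)"
    using \<open>?th1\<close> DERIV_unique by blast
  also have "\<dots> = integral (cbox 0 1) (\<lambda>t. 1 / (2 * of_real pi * \<i>) * (f (circlepath x0 r t, y) / (circlepath x0 r t - x)\<^sup>2
          * (2 * of_real pi * \<i> * of_real r * exp (2 * of_real pi * \<i> * t))))"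
    unfolding contour_integral_integral vector_derivative_circlepath integral_mult_right by simp
  also have "\<dots> = integral (cbox 0 1) (\<lambda>t. f (circlepath x0 r t, y) / (circlepath x0 r t - x)\<^sup>2
          * (of_real r * exp (2 * of_real pi * \<i> * t)))"
    by (intro integral_cong) (simp add: field_simps)
  finally show ?th2 .
qed

lemma continuous_on_pd1:
  assumes "open S" "continuous_on S f"
    "\<And>x y. (x, y) \<in> S \<Longrightarrow> (\<lambda>x'. f (x', y)) field_differentiable (at x)"
  shows "continuous_on S (pd1 f)"
proof -
  have "isCont (pd1 f) (x, y)" if p: "(x, y) \<in> S" for x y
  proof -
    obtain r where r: "r > 0" "cball x r \<times> cball y r \<subseteq> S" using open_prod_cball[OF assms(1) p] .
    have "continuous_on (sphere x r \<times> ball y r) f"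
      by (rule continuous_on_subset[OF assms(2)]) (use r in force)
    then have "continuous_on (ball x r \<times> ball y r) (\<lambda>p. integral (cbox 0 1) (\<lambda>t. (\<lambda>(x', y').
        f (circlepath x r t, y') / (circlepath x r t - x')\<^sup>2 * (of_real r * exp (2 * of_real pi * \<i> * t))) p))"
      using continuous_on_pd1_Cauchy_kernel[of x r "ball y r" f] r(1)
      by (intro integral_continuous_on_param) (simp add: split_beta)
    moreover have "pd1 f p = integral (cbox 0 1) (\<lambda>t. (\<lambda>(x', y').
        f (circlepath x r t, y') / (circlepath x r t - x')\<^sup>2 * (of_real r * exp (2 * of_real pi * \<i> * t))) p)"
      if "p \<in> ball x r \<times> ball y r" for p
      using pd1_eq_integral(2)[OF assms(2,3), of x r "ball y r" "fst p" "snd p"] that r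
      by (auto simp: split_beta subset_iff)
    ultimately have "continuous_on (ball x r \<times> ball y r) (pd1 f)"
      by (metis (no_types, lifting) continuous_on_cong)
    then show ?thesis
      using r(1) by (simp add: continuous_on_eq_continuous_at open_Times)
  qed
  then show ?thesis
    using assms(1) by (force simp: continuous_on_eq_continuous_at)
qed

text \<open>Exchanging the coordinates carries each fact about \<open>pd1\<close> over to
  \<open>pd2\<close>.\<close>

lemma vimage_swap_open: "open S \<Longrightarrow> open (prod.swap -` (S :: ('a::topological_space \<times> 'b::topological_space) set))"
  by (intro open_vimage) (auto intro!: continuous_intros simp: prod.swap_def)

lemma continuous_on_vimage_swap:
  fixes f :: "'a::topological_space \<times> 'b::topological_space \<Rightarrow> 'c::topological_space"
  shows "continuous_on S f \<Longrightarrow> continuous_on (prod.swap -` S) (f \<circ> prod.swap)"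
  by (rule continuous_on_compose)
     (auto intro!: continuous_intros simp: prod.swap_def elim: continuous_on_subset)

lemma continuous_on_pd2:
  assumes "open S" "continuous_on S f"
    "\<And>x y. (x, y) \<in> S \<Longrightarrow> (\<lambda>y'. f (x, y')) field_differentiable (at y)"
  shows "continuous_on S (pd2 f)"
proof -
  have "continuous_on (prod.swap -` S) (pd1 (f \<circ> prod.swap))"
    using assms by (intro continuous_on_pd1 vimage_swap_open continuous_on_vimage_swap) auto
  from continuous_on_vimage_swap[OF this] show ?thesis
    by (simp add: pd2_conv_pd1 vimage_def)
qed

text \<open>A working form of holomorphy: unlike pointwise total differentiability, it passes
  visibly to partial derivatives by means of Cauchy integrals.\<close>

definition sep_holomorphic :: "(complex \<times> complex \<Rightarrow> complex) \<Rightarrow> (complex \<times> complex) set \<Rightarrow> bool" where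
  "sep_holomorphic f S \<longleftrightarrow> continuous_on S f \<and>
     (\<forall>x y. (x, y) \<in> S \<longrightarrow> (\<lambda>x'. f (x', y)) field_differentiable (at x)) \<and>
     (\<forall>x y. (x, y) \<in> S \<longrightarrow> (\<lambda>y'. f (x, y')) field_differentiable (at y))"

lemma sep_holomorphic_swap: "sep_holomorphic f S \<Longrightarrow> sep_holomorphic (f \<circ> prod.swap) (prod.swap -` S)"
  unfolding sep_holomorphic_def using continuous_on_vimage_swap by fastforce

text \<open>The circle moves only the first argument, so y can be differentiated under the integral.
  The Leibniz rule needs continuity of \<open>pd2 f\<close>, which is already available.\<close>

lemma pd1_has_derivative_snd:
  assumes "open S" "sep_holomorphic f S"
    and sub: "cball x0 r \<times> ball y0 r \<subseteq> S" and r: "0 < r" and xy: "x \<in> ball x0 r" "y \<in> ball y0 r"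
  shows "((\<lambda>y'. pd1 f (x, y')) has_field_derivative integral (cbox 0 1) (\<lambda>t.
     pd2 f (circlepath x0 r t, y) / (circlepath x0 r t - x)\<^sup>2 * (of_real r * exp (2 * of_real pi * \<i> * t)))) (at y)"
proof -
  have cont: "continuous_on S f" and d1: "\<And>x y. (x, y) \<in> S \<Longrightarrow> (\<lambda>x'. f (x', y)) field_differentiable (at x)"
    and d2: "\<And>x y. (x, y) \<in> S \<Longrightarrow> (\<lambda>y'. f (x, y')) field_differentiable (at y)"
    using assms(2) by (auto simp: sep_holomorphic_def)
  have circ: "circlepath x0 r t \<in> sphere x0 r" for t :: real
    using r by (simp add: circlepath_def part_circlepath_def dist_norm norm_mult)
  have sub': "sphere x0 r \<times> ball y0 r \<subseteq> S" using sub by force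
  have ker: "continuous_on ((ball x0 r \<times> ball y0 r) \<times> cbox 0 1) (\<lambda>((x, y), t).
     h (circlepath x0 r t, y) / (circlepath x0 r t - x)\<^sup>2 * (of_real r * exp (2 * of_real pi * \<i> * t)))"
    if "continuous_on S h" for h
    using continuous_on_subset[OF that sub'] r by (intro continuous_on_pd1_Cauchy_kernel)
  have "((\<lambda>y'. integral (cbox 0 1) (\<lambda>t. f (circlepath x0 r t, y') / (circlepath x0 r t - x)\<^sup>2
      * (of_real r * exp (2 * of_real pi * \<i> * t)))) has_field_derivative integral (cbox 0 1) (\<lambda>t.
     pd2 f (circlepath x0 r t, y) / (circlepath x0 r t - x)\<^sup>2 * (of_real r * exp (2 * of_real pi * \<i> * t))))
     (at y within ball y0 r)"
  proof (rule leibniz_rule_field_derivative)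
    fix y' and t :: real assume "y' \<in> ball y0 r"
    then have "((\<lambda>y'. f (circlepath x0 r t, y')) has_field_derivative pd2 f (circlepath x0 r t, y')) (at y' within ball y0 r)"
      using d2[of "circlepath x0 r t" y'] circ[of t] sub'
      by (simp add: pd2_def field_differentiable_derivI has_field_derivative_at_within subset_iff)
    then show "((\<lambda>y'. f (circlepath x0 r t, y') / (circlepath x0 r t - x)\<^sup>2 * (of_real r * exp (2 * of_real pi * \<i> * t)))
       has_field_derivative pd2 f (circlepath x0 r t, y') / (circlepath x0 r t - x)\<^sup>2
         * (of_real r * exp (2 * of_real pi * \<i> * t))) (at y' within ball y0 r)"
      by (intro DERIV_cmult_right DERIV_cdivide)
  next
    fix y' assume "y' \<in> ball y0 r"
    then show "(\<lambda>t. f (circlepath x0 r t, y') / (circlepath x0 r t - x)\<^sup>2 * (of_real r * exp (2 * of_real pi * \<i> * t)))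
        integrable_on cbox 0 1"
      using xy by (intro integrable_continuous continuous_on_compose2[OF ker[OF cont], where f="\<lambda>t. ((x, y'), t)", simplified split_beta fst_conv snd_conv]
            continuous_intros) auto
  next
    show "continuous_on (ball y0 r \<times> cbox 0 1) (\<lambda>(y', t). pd2 f (circlepath x0 r t, y') / (circlepath x0 r t - x)\<^sup>2
       * (of_real r * exp (2 * of_real pi * \<i> * t)))"
    proof -
      have "continuous_on (ball y0 r \<times> cbox (0::real) 1) (\<lambda>p. ((x, fst p), snd p))"
        by (intro continuous_intros)
      from continuous_on_compose2[OF ker[OF continuous_on_pd2[OF assms(1) cont d2]] this] show ?thesis
        using xy by (simp add: split_beta image_subset_iff)
    qed
  qed (use xy in auto)
  then show ?thesis
    unfolding at_within_open[OF xy(2) open_ball]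
    by (rule has_field_derivative_transform_within_open[where S = "ball y0 r"])
       (use xy pd1_eq_integral(2)[OF cont d1 sub r xy(1)] in auto)
qed

lemma pd1_differentiable_snd:
  assumes "open S" "sep_holomorphic f S" "(x, y) \<in> S"
  shows "(\<lambda>y'. pd1 f (x, y')) field_differentiable (at y)"
proof -
  obtain r where r: "r > 0" "cball x r \<times> cball y r \<subseteq> S" using open_prod_cball assms by metis
  then have "cball x r \<times> ball y r \<subseteq> S" by force
  from pd1_has_derivative_snd[OF assms(1,2) this r(1), of x y] show ?thesis
    using r(1) unfolding field_differentiable_def by (auto simp: mult.commute)
qed

lemma pd1_differentiable_fst:
  assumes "open S" "sep_holomorphic f S" "(x, y) \<in> S"
  shows "(\<lambda>x'. pd1 f (x', y)) field_differentiable (at x)"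
proof -
  obtain r where r: "r > 0" "cball x r \<times> cball y r \<subseteq> S" using open_prod_cball assms by metis
  have "(\<lambda>x'. f (x', y)) holomorphic_on ball x r"
    unfolding holomorphic_on_def
  proof
    fix x' assume "x' \<in> ball x r"
    then have "(x', y) \<in> S" using r by auto
    then show "(\<lambda>x'. f (x', y)) field_differentiable (at x' within ball x r)"
      using assms(2) unfolding sep_holomorphic_def by (auto intro: field_differentiable_at_within)
  qed
  then have "deriv (\<lambda>x'. f (x', y)) holomorphic_on ball x r" by (rule holomorphic_deriv) simp
  then show ?thesis using r(1) by (simp add: pd1_def holomorphic_on_imp_differentiable_at)
qed

lemma sep_holomorphic_pd1:
  assumes "open S" "sep_holomorphic f S"
  shows "sep_holomorphic (pd1 f) S"
  using assms continuous_on_pd1 pd1_differentiable_fst pd1_differentiable_snd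
  unfolding sep_holomorphic_def by metis

lemma sep_holomorphic_pd2:
  assumes "open S" "sep_holomorphic f S"
  shows "sep_holomorphic (pd2 f) S"
  using sep_holomorphic_swap[OF sep_holomorphic_pd1[OF vimage_swap_open sep_holomorphic_swap], OF assms]
  by (simp add: pd2_conv_pd1 vimage_def)

text \<open>Both sides are the same integral: on the left Cauchy's formula for f differentiated in
  y, on the right Cauchy's formula applied to \<open>pd2 f\<close>.\<close>

lemma pd2_pd1_commute_sep:
  assumes "open S" "sep_holomorphic f S" "(x, y) \<in> S"
  shows "pd2 (pd1 f) (x, y) = pd1 (pd2 f) (x, y)"
proof -
  obtain r where r: "r > 0" "cball x r \<times> cball y r \<subseteq> S" using open_prod_cball assms by metis
  then have sub: "cball x r \<times> ball y r \<subseteq> S" by force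
  have *: "continuous_on S (pd2 f)" "\<And>x y. (x, y) \<in> S \<Longrightarrow> (\<lambda>x'. pd2 f (x', y)) field_differentiable (at x)"
    using sep_holomorphic_pd2[OF assms(1,2)] by (auto simp: sep_holomorphic_def)
  show ?thesis
    using pd1_eq_integral(2)[OF * sub r(1), of x y] pd1_has_derivative_snd[OF assms(1,2) sub r(1), of x y] r(1)
    by (simp add: pd2_def DERIV_imp_deriv)
qed

section \<open>Frechet differentiability versus separate holomorphy\<close>

lemma has_derivative_imp_partials:
  assumes "(f has_derivative (\<lambda>h. a * fst h + b * snd h)) (at (x, y))"
  shows "((\<lambda>x'. f (x', y)) has_field_derivative a) (at x)"
    and "((\<lambda>y'. f (x, y')) has_field_derivative b) (at y)"
    and "pd1 f (x, y) = a" and "pd2 f (x, y) = b"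
proof -
  have "((\<lambda>x'. f (x', y)) has_derivative (\<lambda>h. a * fst (h, 0::complex) + b * snd (h, 0::complex))) (at x)"
    by (rule has_derivative_compose[where g = f and f="\<lambda>x'. (x', y)"])
       (use assms in \<open>auto intro!: derivative_eq_intros\<close>)
  then show 1: "((\<lambda>x'. f (x', y)) has_field_derivative a) (at x)"
    by (simp add: has_field_derivative_def)
  have "((\<lambda>y'. f (x, y')) has_derivative (\<lambda>h. a * fst (0::complex, h) + b * snd (0::complex, h))) (at y)"
    by (rule has_derivative_compose[where g = f and f="\<lambda>y'. (x, y')"])
       (use assms in \<open>auto intro!: derivative_eq_intros\<close>)
  then show 2: "((\<lambda>y'. f (x, y')) has_field_derivative b) (at y)"
    by (simp add: has_field_derivative_def)
  show "pd1 f (x, y) = a" "pd2 f (x, y) = b"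
    using 1 2 by (simp_all add: pd1_def pd2_def DERIV_imp_deriv)
qed

lemma holomorphic2_on_imp_has_derivative:
  assumes "open S" "f holomorphic2_on S" "p \<in> S"
  shows "(f has_derivative (\<lambda>h. pd1 f p * fst h + pd2 f p * snd h)) (at p)"
proof -
  obtain a b where ab: "(f has_derivative (\<lambda>h. a * fst h + b * snd h)) (at p)"
    using assms at_within_open[OF assms(3,1)] unfolding holomorphic2_on_def by metis
  then have "pd1 f p = a" "pd2 f p = b"
    using has_derivative_imp_partials(3,4) by (cases p; blast)+
  with ab show ?thesis by simp
qed

lemma holomorphic2_on_imp_DERIV:
  assumes "open S" "f holomorphic2_on S" "(x, y) \<in> S"
  shows "((\<lambda>x'. f (x', y)) has_field_derivative pd1 f (x, y)) (at x)"
    and "((\<lambda>y'. f (x, y')) has_field_derivative pd2 f (x, y)) (at y)"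
  using has_derivative_imp_partials(1,2)[OF holomorphic2_on_imp_has_derivative[OF assms]] .

lemma holomorphic2_on_imp_continuous_on: "f holomorphic2_on S \<Longrightarrow> continuous_on S f"
  unfolding holomorphic2_on_def continuous_on_eq_continuous_within
  using has_derivative_continuous by blast

text \<open>The direction from right to left is Osgood's lemma: Cauchy's formula makes the partial
  derivatives continuous, and continuous partials give total differentiability.\<close>

lemma holomorphic2_on_iff_sep_holomorphic:
  assumes "open S"
  shows "f holomorphic2_on S \<longleftrightarrow> sep_holomorphic f S"
proof
  assume f: "f holomorphic2_on S"
  show "sep_holomorphic f S"
    unfolding sep_holomorphic_def field_differentiable_def
    using holomorphic2_on_imp_DERIV[OF assms f] holomorphic2_on_imp_continuous_on[OF f] by blast
next
  assume f: "sep_holomorphic f S"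
  show "f holomorphic2_on S"
    unfolding holomorphic2_on_def
  proof safe
    fix x y assume xy: "(x, y) \<in> S"
    obtain r where r: "r > 0" "cball x r \<times> cball y r \<subseteq> S" using open_prod_cball assms xy by metis
    then have sub: "ball x r \<times> ball y r \<subseteq> S" by force
    have c2: "continuous_on S (pd2 f)"
      using sep_holomorphic_pd2[OF assms f] by (simp add: sep_holomorphic_def)
    have "((\<lambda>(x, y). f (x, y)) has_derivative (\<lambda>(tx, ty). pd1 f (x, y) * tx + blinfun_mult_right (pd2 f (x, y)) ty))
        (at (x, y) within ball x r \<times> ball y r)"
    proof (rule has_derivative_partialsI)
      have "(\<lambda>x'. f (x', y)) field_differentiable (at x)"
        using f xy by (simp add: sep_holomorphic_def)
      then show "((\<lambda>x. f (x, y)) has_derivative (*) (pd1 f (x, y))) (at x within ball x r)"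
        by (simp add: pd1_def field_differentiable_derivI has_field_derivative_at_within
            flip: has_field_derivative_def)
    next
      fix x' y' assume "x' \<in> ball x r" "y' \<in> ball y r"
      then have "(x', y') \<in> S" using sub by auto
      then have "(\<lambda>y'. f (x', y')) field_differentiable (at y')"
        using f by (simp add: sep_holomorphic_def)
      then show "((\<lambda>y. f (x', y)) has_derivative blinfun_apply (blinfun_mult_right (pd2 f (x', y')))) (at y' within ball y r)"
        by (simp add: pd2_def field_differentiable_derivI has_field_derivative_at_within
            flip: has_field_derivative_def)
    next
      have "continuous_on (ball x r \<times> ball y r) (\<lambda>(x, y). blinfun_mult_right (pd2 f (x, y)))"
        unfolding split_beta
        by (intro continuous_intros bounded_linear.continuous_on[OF bounded_linear_blinfun_mult_right]
            continuous_on_compose2[OF c2]) (use sub in auto)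
      then show "continuous (at (x, y) within ball x r \<times> ball y r) (\<lambda>(x, y). blinfun_mult_right (pd2 f (x, y)))"
        using r(1) by (simp add: continuous_on_eq_continuous_within case_prod_beta')
    qed (use r in auto)
    then have "(f has_derivative (\<lambda>h. pd1 f (x, y) * fst h + pd2 f (x, y) * snd h)) (at (x, y))"
      using r(1) at_within_open[of "(x, y)" "ball x r \<times> ball y r"] by (simp add: open_Times case_prod_beta')
    then show "\<exists>a b. (f has_derivative (\<lambda>h. a * fst h + b * snd h)) (at (x, y) within S)"
      by (meson has_derivative_at_withinI)
  qed
qed

lemma holomorphic2_pd1: "open S \<Longrightarrow> f holomorphic2_on S \<Longrightarrow> pd1 f holomorphic2_on S"
  and holomorphic2_pd2: "open S \<Longrightarrow> f holomorphic2_on S \<Longrightarrow> pd2 f holomorphic2_on S"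
  by (simp_all add: holomorphic2_on_iff_sep_holomorphic sep_holomorphic_pd1 sep_holomorphic_pd2)

lemma pd2_pd1_commute:
  "open S \<Longrightarrow> f holomorphic2_on S \<Longrightarrow> p \<in> S \<Longrightarrow> pd2 (pd1 f) p = pd1 (pd2 f) p"
  using pd2_pd1_commute_sep by (cases p) (auto simp: holomorphic2_on_iff_sep_holomorphic)

section \<open>Congruence and linearity of partial derivatives\<close>

lemma holomorphic2_on_cong: "(\<And>p. p \<in> S \<Longrightarrow> f p = h p) \<Longrightarrow> f holomorphic2_on S \<Longrightarrow> h holomorphic2_on S"
  unfolding holomorphic2_on_def
proof
  fix p assume eq: "\<And>p. p \<in> S \<Longrightarrow> f p = h p" and p: "p \<in> S"
    and "\<forall>p\<in>S. \<exists>a b. (f has_derivative (\<lambda>h. a * fst h + b * snd h)) (at p within S)"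
  then obtain a b where "(f has_derivative (\<lambda>h. a * fst h + b * snd h)) (at p within S)" by blast
  then have "(h has_derivative (\<lambda>h. a * fst h + b * snd h)) (at p within S)"
    by (rule has_derivative_transform[OF p, rotated]) (simp add: eq)
  then show "\<exists>a b. (h has_derivative (\<lambda>h. a * fst h + b * snd h)) (at p within S)" by blast
qed

text \<open>Formulas for extensional functions hold on the domain only. Iterated partials can still
  be rewritten there, since an open set contains a neighbourhood of each of its points.\<close>

lemma pd1_cong:
  assumes "open S" "p \<in> S" "\<And>q. q \<in> S \<Longrightarrow> f q = h q"
  shows "pd1 f p = pd1 h p"
proof -
  obtain x y where p: "p = (x, y)" by (cases p)
  have "open ((\<lambda>x'. (x', y)) -` S)"
    using assms(1) by (intro open_vimage) (auto intro!: continuous_intros)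
  then have "eventually (\<lambda>x'. x' \<in> (\<lambda>x'. (x', y)) -` S) (nhds x)"
    using assms(2) p by (intro eventually_nhds_in_open) auto
  then show ?thesis
    unfolding pd1_def p split using assms(3) by (intro deriv_cong_ev) (auto elim!: eventually_mono)
qed

lemma pd2_cong:
  assumes "open S" "p \<in> S" "\<And>q. q \<in> S \<Longrightarrow> f q = h q"
  shows "pd2 f p = pd2 h p"
  using pd1_cong[OF vimage_swap_open[OF assms(1)], of "prod.swap p" "f \<circ> prod.swap" "h \<circ> prod.swap"] assms
  by (simp add: pd2_conv_pd1)

lemma pd_linear:
  assumes "open S" "f holomorphic2_on S" "h holomorphic2_on S" "p \<in> S"
  shows "pd1 (\<lambda>q. a * f q + b * h q) p = a * pd1 f p + b * pd1 h p"
    and "pd2 (\<lambda>q. a * f q + b * h q) p = a * pd2 f p + b * pd2 h p"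
proof -
  obtain x y where p: "p = (x, y)" by (cases p)
  note d = holomorphic2_on_imp_DERIV[OF assms(1,2), of x y] holomorphic2_on_imp_DERIV[OF assms(1,3), of x y]
  show "pd1 (\<lambda>q. a * f q + b * h q) p = a * pd1 f p + b * pd1 h p"
    using d assms(4) unfolding p by (subst pd1_def) (auto intro!: DERIV_imp_deriv derivative_eq_intros)
  show "pd2 (\<lambda>q. a * f q + b * h q) p = a * pd2 f p + b * pd2 h p"
    using d assms(4) unfolding p by (subst pd2_def) (auto intro!: DERIV_imp_deriv derivative_eq_intros)
qed

lemma holomorphic2_linear:
  assumes "f holomorphic2_on S" "h holomorphic2_on S"
  shows "(\<lambda>q. a * f q + b * h q) holomorphic2_on S"
  unfolding holomorphic2_on_def
proof
  fix p assume "p \<in> S"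
  with assms obtain a1 b1 a2 b2 where
    "(f has_derivative (\<lambda>h. a1 * fst h + b1 * snd h)) (at p within S)"
    "(h has_derivative (\<lambda>h. a2 * fst h + b2 * snd h)) (at p within S)"
    unfolding holomorphic2_on_def by (meson \<open>p \<in> S\<close>)
  then have "((\<lambda>q. a * f q + b * h q) has_derivative
     (\<lambda>h. a * (a1 * fst h + b1 * snd h) + b * (a2 * fst h + b2 * snd h))) (at p within S)"
    by (auto intro!: derivative_eq_intros)
  then have "((\<lambda>q. a * f q + b * h q) has_derivative
     (\<lambda>h. (a * a1 + b * a2) * fst h + (a * b1 + b * b2) * snd h)) (at p within S)"
    by (simp add: algebra_simps)
  then show "\<exists>a' b'. ((\<lambda>q. a * f q + b * h q) has_derivative (\<lambda>h. a' * fst h + b' * snd h)) (at p within S)"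
    by blast
qed

section \<open>The integral operator\<close>

text \<open>The chord is parametrised from x at v = -1 to y at v = 1.\<close>

definition chord_point :: "complex \<times> complex \<Rightarrow> real \<Rightarrow> complex" where
  "chord_point = (\<lambda>(x, y) v. ((y - x) * of_real v + (x + y)) / 2)"

text \<open>The weight is left free so that the class is closed under partial derivatives: each of
  them replaces g by \<open>deriv g\<close> and multiplies the weight by (1 - v)/2 or (1 +
  v)/2.\<close>

definition chord_int :: "(complex \<Rightarrow> complex) \<Rightarrow> (real \<Rightarrow> complex) \<Rightarrow> complex \<times> complex \<Rightarrow> complex" where
  "chord_int g w p = integral {-1..1} (\<lambda>v. g (chord_point p v) * w v)"

lemma chord_point_in:
  assumes "convex D" "p \<in> D \<times> D" "v \<in> {-1..1}"
  shows "chord_point p v \<in> D"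
proof -
  obtain x y where p: "p = (x, y)" by (cases p)
  have "((1 - v) / 2) *\<^sub>R x + ((1 + v) / 2) *\<^sub>R y \<in> D"
    using assms p by (intro convexD) (auto simp: field_simps)
  moreover have "((1 - v) / 2) *\<^sub>R x + ((1 + v) / 2) *\<^sub>R y = chord_point p v"
    unfolding p chord_point_def scaleR_conv_of_real by (simp add: field_simps)
  ultimately show ?thesis by simp
qed

lemma continuous_on_chord_point: "continuous_on A (\<lambda>(p, v). chord_point p v)"
  unfolding chord_point_def split_beta by (intro continuous_intros) auto

lemma continuous_on_chord_kernel:
  fixes g :: "complex \<Rightarrow> complex" and w :: "real \<Rightarrow> complex"
  assumes "convex D" "continuous_on D g" "continuous_on {-1..1} w"
  shows "continuous_on ((D \<times> D) \<times> {-1..1}) (\<lambda>(p, v). g (chord_point p v) * w v)"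
  unfolding split_beta
  by (intro continuous_intros continuous_on_compose2[OF assms(2)] continuous_on_compose2[OF assms(3)]
      continuous_on_chord_point[unfolded split_beta])
     (auto intro!: chord_point_in[OF assms(1)] simp del: atLeastAtMost_iff)

lemma chord_integrable:
  fixes g :: "complex \<Rightarrow> complex" and w :: "real \<Rightarrow> complex"
  assumes "convex D" "continuous_on D g" "continuous_on {-1..1} w" "p \<in> D \<times> D"
  shows "(\<lambda>v. g (chord_point p v) * w v) integrable_on {-1..1}"
proof (rule integrable_continuous_real)
  have "continuous_on {-1..1::real} (\<lambda>v. (p, v))" by (intro continuous_intros)
  from continuous_on_compose2[OF continuous_on_chord_kernel[OF assms(1-3)] this]
  show "continuous_on {-1..1} (\<lambda>v. g (chord_point p v) * w v)"
    using assms(4) by (simp add: image_subset_iff)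
qed

lemma continuous_on_chord_int:
  assumes "convex D" "continuous_on D g" "continuous_on {-1..1} w"
  shows "continuous_on (D \<times> D) (chord_int g w)"
  using integral_continuous_on_param[OF continuous_on_chord_kernel[OF assms, folded cbox_interval]]
  by (simp add: chord_int_def[abs_def])

lemma chord_int_has_derivative:
  assumes D: "convex D" "open D" and g: "g holomorphic_on D" and w: "continuous_on {-1..1} w"
    and xy: "x \<in> D" "y \<in> D"
  shows "((\<lambda>x. chord_int g w (x, y)) has_field_derivative
           chord_int (deriv g) (\<lambda>v. of_real ((1 - v) / 2) * w v) (x, y)) (at x)" (is ?th1)
    and "((\<lambda>y. chord_int g w (x, y)) has_field_derivative
           chord_int (deriv g) (\<lambda>v. of_real ((1 + v) / 2) * w v) (x, y)) (at y)" (is ?th2)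
proof -
  have dg: "(g has_field_derivative deriv g z) (at z)" if "z \<in> D" for z
    using g D that by (simp add: holomorphic_derivI)
  have cg: "continuous_on D g" "continuous_on D (deriv g)"
    using g D by (auto intro!: holomorphic_on_imp_continuous_on holomorphic_deriv)
  have w': "continuous_on {-1..1} (\<lambda>v. of_real ((1 - v) / 2) * w v)"
    "continuous_on {-1..1} (\<lambda>v. of_real ((1 + v) / 2) * w v)"
    using w by (auto intro!: continuous_intros)
  have d1: "((\<lambda>x. chord_point (x, y) v) has_field_derivative of_real ((1 - v) / 2)) (at x within D)" for x y v
    unfolding chord_point_def by (auto intro!: derivative_eq_intros)
  have d2: "((\<lambda>y. chord_point (x, y) v) has_field_derivative of_real ((1 + v) / 2)) (at y within D)" for x y v
    unfolding chord_point_def by (auto intro!: derivative_eq_intros)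
  have "((\<lambda>x. integral (cbox (-1) 1) (\<lambda>v. g (chord_point (x, y) v) * w v)) has_field_derivative
    integral (cbox (-1) 1) (\<lambda>v. deriv g (chord_point (x, y) v) * (of_real ((1 - v) / 2) * w v))) (at x within D)"
  proof (rule leibniz_rule_field_derivative)
    fix x and v :: real assume "x \<in> D" "v \<in> cbox (-1) 1"
    then show "((\<lambda>x. g (chord_point (x, y) v) * w v) has_field_derivative
        deriv g (chord_point (x, y) v) * (of_real ((1 - v) / 2) * w v)) (at x within D)"
      using DERIV_cmult_right[OF DERIV_chain2[OF dg[OF chord_point_in] d1], of _ _ _ "w v"] D xy
      by (simp add: mult.assoc)
  next
    show "continuous_on (D \<times> cbox (-1) 1) (\<lambda>(x, v). deriv g (chord_point (x, y) v) * (of_real ((1 - v) / 2) * w v))"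
    proof -
      have "continuous_on (D \<times> {-1..1::real}) (\<lambda>p. ((fst p, y), snd p))" by (intro continuous_intros)
      from continuous_on_compose2[OF continuous_on_chord_kernel[OF D(1) cg(2) w'(1)] this] show ?thesis
        using xy by (simp add: split_beta image_subset_iff)
    qed
  qed (use D xy cg w chord_integrable in auto)
  then show ?th1 unfolding at_within_open[OF xy(1) D(2)] by (simp add: chord_int_def)
  have "((\<lambda>y. integral (cbox (-1) 1) (\<lambda>v. g (chord_point (x, y) v) * w v)) has_field_derivative
    integral (cbox (-1) 1) (\<lambda>v. deriv g (chord_point (x, y) v) * (of_real ((1 + v) / 2) * w v))) (at y within D)"
  proof (rule leibniz_rule_field_derivative)
    fix y and v :: real assume "y \<in> D" "v \<in> cbox (-1) 1"
    then show "((\<lambda>y. g (chord_point (x, y) v) * w v) has_field_derivative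
        deriv g (chord_point (x, y) v) * (of_real ((1 + v) / 2) * w v)) (at y within D)"
      using DERIV_cmult_right[OF DERIV_chain2[OF dg[OF chord_point_in] d2], of _ _ _ "w v"] D xy
      by (simp add: mult.assoc)
  next
    show "continuous_on (D \<times> cbox (-1) 1) (\<lambda>(y, v). deriv g (chord_point (x, y) v) * (of_real ((1 + v) / 2) * w v))"
    proof -
      have "continuous_on (D \<times> {-1..1::real}) (\<lambda>p. ((x, fst p), snd p))" by (intro continuous_intros)
      from continuous_on_compose2[OF continuous_on_chord_kernel[OF D(1) cg(2) w'(2)] this] show ?thesis
        using xy by (simp add: split_beta image_subset_iff)
    qed
  qed (use D xy cg w chord_integrable in auto)
  then show ?th2 unfolding at_within_open[OF xy(2) D(2)] by (simp add: chord_int_def)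
qed

lemma chord_int_holomorphic2:
  assumes D: "convex D" "open D" and g: "g holomorphic_on D" and w: "continuous_on {-1..1} w"
  shows "chord_int g w holomorphic2_on (D \<times> D)"
  unfolding holomorphic2_on_iff_sep_holomorphic[OF open_Times[OF D(2) D(2)]] sep_holomorphic_def
  unfolding field_differentiable_def
  using chord_int_has_derivative[OF assms]
    continuous_on_chord_int[OF D(1) holomorphic_on_imp_continuous_on[OF g] w]
  by blast

lemma pd_chord_int:
  assumes D: "convex D" "open D" and g: "g holomorphic_on D" and w: "continuous_on {-1..1} w" and p: "p \<in> D \<times> D"
  shows "pd1 (chord_int g w) p = chord_int (deriv g) (\<lambda>v. of_real ((1 - v) / 2) * w v) p"
    and "pd2 (chord_int g w) p = chord_int (deriv g) (\<lambda>v. of_real ((1 + v) / 2) * w v) p"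
  using chord_int_has_derivative[OF D g w] p by (auto simp: pd1_def pd2_def intro!: DERIV_imp_deriv)

text \<open>Conjugation by (x - y)^l. This power is itself an eigenfunction with eigenvalue -l(l+1),
  so the product solves the equation as soon as J satisfies the Euler-Poisson-Darboux equation (x -
  y) J_xy = (l + 1)(J_x - J_y).\<close>

lemma P_op_power_mult:
  assumes S: "open S" "J holomorphic2_on S" and p: "(x, y) \<in> S"
  shows "P_op (\<lambda>(x, y). (x - y) ^ l * J (x, y)) (x, y) =
    (x - y) ^ l * ((x - y)\<^sup>2 * pd1 (pd2 J) (x, y)
      - (of_nat l + 1) * (x - y) * (pd1 J (x, y) - pd2 J (x, y)) - of_nat l * (of_nat l + 1) * J (x, y))"
proof -
  note d = holomorphic2_on_imp_DERIV[OF S]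
  have pd1: "pd1 (\<lambda>(x, y). (x - y) ^ l * J (x, y)) (x, y)
      = of_nat l * (x - y) ^ (l - 1) * J (x, y) + (x - y) ^ l * pd1 J (x, y)" if "(x, y) \<in> S" for x y
    using d[OF that] by (subst pd1_def) (auto intro!: DERIV_imp_deriv derivative_eq_intros)
  have pd2: "pd2 (\<lambda>(x, y). (x - y) ^ l * J (x, y)) (x, y)
      = - of_nat l * (x - y) ^ (l - 1) * J (x, y) + (x - y) ^ l * pd2 J (x, y)" if "(x, y) \<in> S" for x y
    using d[OF that] by (subst pd2_def) (auto intro!: DERIV_imp_deriv derivative_eq_intros)
  have "pd1 (pd2 (\<lambda>(x, y). (x - y) ^ l * J (x, y))) (x, y)
     = pd1 (\<lambda>(x, y). - of_nat l * (x - y) ^ (l - 1) * J (x, y) + (x - y) ^ l * pd2 J (x, y)) (x, y)"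
    by (rule pd1_cong[OF S(1) p]) (use pd2 in auto)
  also have "\<dots> = - of_nat l * (of_nat (l - 1) * (x - y) ^ (l - 1 - 1) * J (x, y) + (x - y) ^ (l - 1) * pd1 J (x, y))
      + (of_nat l * (x - y) ^ (l - 1) * pd2 J (x, y) + (x - y) ^ l * pd1 (pd2 J) (x, y))"
    using d[OF p] holomorphic2_on_imp_DERIV[OF S(1) holomorphic2_pd2[OF S] p]
    by (subst pd1_def) (auto intro!: DERIV_imp_deriv derivative_eq_intros; simp add: algebra_simps)
  finally have pd12: "pd1 (pd2 (\<lambda>(x, y). (x - y) ^ l * J (x, y))) (x, y) = \<dots>" .
  \<comment> \<open>The exponents l - 1 and l - 1 - 1 are truncated for l < 2; there the
    coefficients l and l(l - 1) make the affected terms vanish.\<close>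
  consider "l = 0" | "l = 1" | k where "l = Suc (Suc k)"
    by (metis One_nat_def not0_implies_Suc)
  then show ?thesis
    unfolding P_op_def split pd12 pd1[OF p] pd2[OF p]
    by cases (simp_all add: algebra_simps power2_eq_square)
qed

text \<open>The orthogonality weight of the Gegenbauer polynomials with parameter l + 1/2.\<close>

definition gegenbauer_weight :: "nat \<Rightarrow> real \<Rightarrow> complex" where
  "gegenbauer_weight l v = of_real ((1 - v\<^sup>2) ^ l)"

lemma continuous_on_gegenbauer_weight: "continuous_on A (gegenbauer_weight l)"
  unfolding gegenbauer_weight_def by (intro continuous_intros)

lemma Psi_eq: "p \<in> D \<times> D \<Longrightarrow> Psi D l g p = (case p of (x, y) \<Rightarrow> (x - y) ^ l * chord_int g (gegenbauer_weight l) (x, y))"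
  by (auto simp: Psi_def chord_int_def chord_point_def gegenbauer_weight_def)

text \<open>The boundary terms vanish because the exponent \<open>Suc l\<close> is positive even for
  l = 0. Applied to h = \<open>deriv g\<close>, this lowers the second derivative of g in the mixed
  partial to the first derivative occurring in J_x - J_y.\<close>

lemma chord_int_by_parts:
  assumes D: "convex D" "open D" and h: "h holomorphic_on D" and xy: "x \<in> D" "y \<in> D"
  shows "(y - x) * chord_int (deriv h) (gegenbauer_weight (Suc l)) (x, y)
    = 4 * (of_nat l + 1) * chord_int h (\<lambda>v. of_real v * gegenbauer_weight l v) (x, y)"
proof -
  let ?c = "chord_point (x, y)"
  have ch: "continuous_on D h" "continuous_on D (deriv h)"
    using h D by (auto intro!: holomorphic_on_imp_continuous_on holomorphic_deriv)
  have "((\<lambda>v. (y - x) / 2 * (deriv h (?c v) * gegenbauer_weight (Suc l) v)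
        - 2 * (of_nat l + 1) * (h (?c v) * (of_real v * gegenbauer_weight l v))) has_integral
       h (?c 1) * gegenbauer_weight (Suc l) 1 - h (?c (-1)) * gegenbauer_weight (Suc l) (-1)) {-1..1}"
  proof (rule fundamental_theorem_of_calculus)
    fix v :: real assume v: "v \<in> {-1..1}"
    have "(h has_field_derivative deriv h (?c v)) (at (?c v))"
      using h D chord_point_in[OF D(1), of "(x, y)" v] v xy by (intro holomorphic_derivI) auto
    moreover have "(?c has_vector_derivative (y - x) / 2) (at v within {-1..1})"
      unfolding chord_point_def split by (auto intro!: derivative_eq_intros simp: has_vector_derivative_def scaleR_conv_of_real)
    ultimately have 1: "((\<lambda>v. h (?c v)) has_vector_derivative (y - x) / 2 * deriv h (?c v)) (at v within {-1..1})"
      using field_vector_diff_chain_within[of ?c "(y - x) / 2" v "{-1..1}" h "deriv h (?c v)"]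
      by (simp add: o_def has_field_derivative_at_within)
    have "((\<lambda>v. (1 - v\<^sup>2) ^ Suc l) has_field_derivative (- 2 * (real l + 1) * v * (1 - v\<^sup>2) ^ l)) (at v within {-1..1})"
      by (auto intro!: derivative_eq_intros simp del: power_Suc; simp add: algebra_simps)
    then have 2: "(gegenbauer_weight (Suc l) has_vector_derivative of_real (- 2 * (real l + 1) * v * (1 - v\<^sup>2) ^ l)) (at v within {-1..1})"
      unfolding gegenbauer_weight_def
      by (intro has_vector_derivative_of_real) (simp add: has_real_derivative_iff_has_vector_derivative)
    show "((\<lambda>v. h (?c v) * gegenbauer_weight (Suc l) v) has_vector_derivative
        (y - x) / 2 * (deriv h (?c v) * gegenbauer_weight (Suc l) v)
        - 2 * (of_nat l + 1) * (h (?c v) * (of_real v * gegenbauer_weight l v))) (at v within {-1..1})"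
      by (rule has_vector_derivative_eq_rhs[OF has_vector_derivative_mult[OF 1 2]])
         (simp add: gegenbauer_weight_def algebra_simps)
  qed simp
  then have "0 = integral {-1..1} (\<lambda>v. (y - x) / 2 * (deriv h (?c v) * gegenbauer_weight (Suc l) v)
        - 2 * (of_nat l + 1) * (h (?c v) * (of_real v * gegenbauer_weight l v)))"
    by (simp add: integral_unique gegenbauer_weight_def)
  also have "\<dots> = (y - x) / 2 * chord_int (deriv h) (gegenbauer_weight (Suc l)) (x, y)
        - 2 * (of_nat l + 1) * chord_int h (\<lambda>v. of_real v * gegenbauer_weight l v) (x, y)"
    unfolding chord_int_def integral_mult_right[symmetric]
    by (intro integral_diff integrable_on_mult_right chord_integrable[OF D(1)] ch continuous_intros
         continuous_on_gegenbauer_weight) (use xy in auto)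
  finally show ?thesis by (simp add: field_simps)
qed

lemma Psi_in_Sol:
  assumes D: "convex D" "open D" and g: "g holomorphic_on D"
  shows "Psi D l g \<in> Sol D l"
proof -
  let ?w = "gegenbauer_weight l" and ?S = "D \<times> D"
  let ?J = "chord_int g ?w"
  note cw = continuous_on_gegenbauer_weight
  have S: "open ?S" using D by (simp add: open_Times)
  have J: "?J holomorphic2_on ?S" by (intro chord_int_holomorphic2 D g cw)
  have g': "deriv g holomorphic_on D" using g D by (simp add: holomorphic_deriv)
  have "(\<lambda>(x, y). (x - y) ^ l * ?J (x, y)) holomorphic2_on ?S"
    unfolding holomorphic2_on_iff_sep_holomorphic[OF S] sep_holomorphic_def
  proof (intro conjI allI impI)
    show "continuous_on ?S (\<lambda>(x, y). (x - y) ^ l * ?J (x, y))"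
      using holomorphic2_on_imp_continuous_on[OF J] unfolding split_beta prod.collapse
      by (intro continuous_intros)
    fix x y assume "(x, y) \<in> ?S"
    note d = holomorphic2_on_imp_DERIV[OF S J this]
    show "(\<lambda>x'. case (x', y) of (x, y) \<Rightarrow> (x - y) ^ l * ?J (x, y)) field_differentiable at x"
      using d(1) unfolding split by (intro derivative_intros) (auto simp: field_differentiable_def)
    show "(\<lambda>y'. case (x, y') of (x, y) \<Rightarrow> (x - y) ^ l * ?J (x, y)) field_differentiable at y"
      using d(2) unfolding split by (intro derivative_intros) (auto simp: field_differentiable_def)
  qed
  then have "Psi D l g holomorphic2_on ?S"
    by (rule holomorphic2_on_cong[rotated]) (simp add: Psi_eq)
  moreover have "P_op (Psi D l g) p = - (of_nat l * (of_nat l + 1)) * Psi D l g p" if p: "p \<in> ?S" for p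
  proof -
    obtain x y where xy: "p = (x, y)" "x \<in> D" "y \<in> D" using p by auto
    have cw': "continuous_on {-1..1} (\<lambda>v. of_real ((1 + v) / 2) * ?w v)"
      "continuous_on {-1..1} (\<lambda>v. of_real ((1 - v) / 2) * ?w v)"
      by (auto intro!: continuous_intros cw)
    have "P_op (Psi D l g) p = P_op (\<lambda>(x, y). (x - y) ^ l * ?J (x, y)) p"
    proof -
      have "pd2 (Psi D l g) q = pd2 (\<lambda>(x, y). (x - y) ^ l * ?J (x, y)) q" if "q \<in> ?S" for q
        by (rule pd2_cong[OF S that]) (rule Psi_eq)
      then have "pd1 (pd2 (Psi D l g)) p = pd1 (pd2 (\<lambda>(x, y). (x - y) ^ l * ?J (x, y))) p"
        by (rule pd1_cong[OF S p])
      moreover have "pd2 (Psi D l g) p = pd2 (\<lambda>(x, y). (x - y) ^ l * ?J (x, y)) p"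
        by (rule pd2_cong[OF S p]) (rule Psi_eq)
      moreover have "pd1 (Psi D l g) p = pd1 (\<lambda>(x, y). (x - y) ^ l * ?J (x, y)) p"
        by (rule pd1_cong[OF S p]) (rule Psi_eq)
      ultimately show ?thesis unfolding P_op_def xy(1) by simp
    qed
    also have "\<dots> = (x - y) ^ l * ((x - y)\<^sup>2 * pd1 (pd2 ?J) (x, y)
      - (of_nat l + 1) * (x - y) * (pd1 ?J (x, y) - pd2 ?J (x, y)) - of_nat l * (of_nat l + 1) * ?J (x, y))"
      unfolding xy(1) by (rule P_op_power_mult[OF S J]) (use xy in auto)
    also have "pd1 (pd2 ?J) (x, y) = pd1 (chord_int (deriv g) (\<lambda>v. of_real ((1 + v) / 2) * ?w v)) (x, y)"
      by (rule pd1_cong[OF S]) (use xy pd_chord_int[OF D g cw] in auto)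
    also have "\<dots> = chord_int (deriv (deriv g)) (\<lambda>v. of_real ((1 - v) / 2) * (of_real ((1 + v) / 2) * ?w v)) (x, y)"
      by (rule pd_chord_int[OF D g' cw'(1)]) (use xy in auto)
    \<comment> \<open>The factors (1 - v)/2 and (1 + v)/2 from the two differentiations raise the
      weight from l to l + 1, as partial integration requires.\<close>
    also have "\<dots> = chord_int (deriv (deriv g)) (gegenbauer_weight (Suc l)) (x, y) / 4"
      unfolding chord_int_def gegenbauer_weight_def integral_divide[symmetric]
      by (intro integral_cong) (simp add: field_simps power2_eq_square)
    also have "pd1 ?J (x, y) - pd2 ?J (x, y) = - chord_int (deriv g) (\<lambda>v. of_real v * ?w v) (x, y)"
    proof -
      have "pd1 ?J (x, y) - pd2 ?J (x, y)
         = chord_int (deriv g) (\<lambda>v. of_real ((1 - v) / 2) * ?w v) (x, y) - chord_int (deriv g) (\<lambda>v. of_real ((1 + v) / 2) * ?w v) (x, y)"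
        using xy pd_chord_int[OF D g cw] by simp
      also have "\<dots> = integral {-1..1} (\<lambda>v. deriv g (chord_point (x, y) v) * (of_real ((1 - v) / 2) * ?w v)
          - deriv g (chord_point (x, y) v) * (of_real ((1 + v) / 2) * ?w v))"
        unfolding chord_int_def using xy
        by (intro integral_diff[symmetric] chord_integrable[OF D(1)] cw' holomorphic_on_imp_continuous_on g') auto
      also have "\<dots> = integral {-1..1} (\<lambda>v. - (deriv g (chord_point (x, y) v) * (of_real v * ?w v)))"
        by (intro integral_cong) (simp add: field_simps)
      finally show ?thesis by (simp add: chord_int_def)
    qed
    \<comment> \<open>After partial integration the second-order term cancels the first-order one,
      and only -l(l+1) J remains in the bracket.\<close>
    also have "(x - y)\<^sup>2 * (chord_int (deriv (deriv g)) (gegenbauer_weight (Suc l)) (x, y) / 4)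
       = - (x - y) * (of_nat l + 1) * chord_int (deriv g) (\<lambda>v. of_real v * ?w v) (x, y)"
      using chord_int_by_parts[OF D g' xy(2,3), of l] by (simp add: power2_eq_square) algebra
    finally show ?thesis using p unfolding Psi_eq[OF p] unfolding xy(1) by (simp add: algebra_simps)
  qed
  moreover have "Psi D l g \<in> extensional ?S"
    by (auto simp: Psi_def)
  ultimately show ?thesis by (simp add: Sol_def Hol2_def)
qed

text \<open>The substitution s = (1 + v)/2 identifies the integral with 2 B(a+1, b+1). Partial
  integration lowers \<open>a\<close> while raising \<open>b\<close>, hence the induction for
  arbitrary \<open>b\<close>.\<close>

lemma integral_chord_weights:
  "((\<lambda>v. ((1 - v) / 2) ^ a * ((1 + v) / 2) ^ b) has_integral (2 * fact a * fact b / fact (a + b + 1) :: real)) {-1..1}"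
proof (induction a arbitrary: b)
  case 0
  have "((\<lambda>v. ((1 + v) / 2) ^ b) has_integral
      (2 / (real b + 1) * ((1 + 1) / 2) ^ Suc b - 2 / (real b + 1) * ((1 + (-1)) / 2) ^ Suc b)) {-1..1}"
  proof (rule fundamental_theorem_of_calculus)
    fix v :: real
    have "((\<lambda>v. ((1 + v) / 2) ^ Suc b) has_field_derivative (1 + real b) * (((1 + v) / 2) ^ b * (1 / 2))) (at v within {-1..1})"
      by (auto intro!: derivative_eq_intros simp del: power_Suc)
    from DERIV_cmult[OF this, of "2 / (real b + 1)"]
    have "((\<lambda>v. 2 / (real b + 1) * ((1 + v) / 2) ^ Suc b) has_field_derivative
       2 / (real b + 1) * ((1 + real b) * (((1 + v) / 2) ^ b * (1 / 2)))) (at v within {-1..1})" .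
    moreover have "2 / (real b + 1) * ((1 + real b) * (X * (1 / 2))) = X" for X
      using of_nat_0_le_iff[of b] by (simp add: divide_simps add_nonneg_eq_0_iff)
    ultimately show "((\<lambda>v. 2 / (real b + 1) * ((1 + v) / 2) ^ Suc b) has_vector_derivative ((1 + v) / 2) ^ b)
       (at v within {-1..1})"
      unfolding has_real_derivative_iff_has_vector_derivative by (rule has_vector_derivative_eq_rhs)
  qed simp
  then show ?case by (simp add: add.commute)
next
  case (Suc a)
  have alg: "(1 + A) * (Q * (- 1 / 2)) * (p * P) + (1 + B) * (P * (1 / 2)) * (q * Q)
      = (B + 1) / 2 * (q * Q * P) - (A + 1) / 2 * (Q * (p * P))" for A B P Q p q :: real
    by (simp add: field_simps)
  let ?p = "\<lambda>v::real. (1 + v) / 2" and ?q = "\<lambda>v::real. (1 - v) / 2"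
  \<comment> \<open>The integrand is the derivative of \<open>?q v ^ Suc a * ?p v ^ Suc b\<close>,
    which vanishes at both end points; so the integral for (a+1, b) is (a+1)/(b+1) times the one for
    (a, b+1).\<close>
  have "((\<lambda>v. (real b + 1) / 2 * (?q v ^ Suc a * ?p v ^ b) - (real a + 1) / 2 * (?q v ^ a * ?p v ^ Suc b)) has_integral
      (?q 1 ^ Suc a * ?p 1 ^ Suc b - ?q (-1) ^ Suc a * ?p (-1) ^ Suc b)) {-1..1}"
  proof (rule fundamental_theorem_of_calculus)
    fix v :: real
    have "((\<lambda>v. ?q v ^ Suc a * ?p v ^ Suc b) has_field_derivative
        (1 + real a) * (?q v ^ a * (- 1 / 2)) * ?p v ^ Suc b + (1 + real b) * (?p v ^ b * (1 / 2)) * ?q v ^ Suc a)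
        (at v within {-1..1})"
      by (auto intro!: derivative_eq_intros simp del: power_Suc)
    then show "((\<lambda>v. ?q v ^ Suc a * ?p v ^ Suc b) has_vector_derivative
        (real b + 1) / 2 * (?q v ^ Suc a * ?p v ^ b) - (real a + 1) / 2 * (?q v ^ a * ?p v ^ Suc b)) (at v within {-1..1})"
      unfolding has_real_derivative_iff_has_vector_derivative
      by (rule has_vector_derivative_eq_rhs) (simp only: power_Suc alg)
  qed simp
  from has_integral_add[OF this has_integral_mult_right[OF Suc.IH[of "Suc b"], of "(real a + 1) / 2"]]
  have "((\<lambda>v. (real b + 1) / 2 * (?q v ^ Suc a * ?p v ^ b)) has_integral
     (real a + 1) / 2 * (2 * fact a * fact (Suc b) / fact (a + Suc b + 1))) {-1..1}"
    by simp
  from has_integral_mult_right[OF this, of "2 / (real b + 1)"]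
  have "((\<lambda>v. 2 / (real b + 1) * ((real b + 1) / 2 * (?q v ^ Suc a * ?p v ^ b))) has_integral
     2 / (real b + 1) * ((real a + 1) / 2 * (2 * fact a * fact (Suc b) / fact (a + Suc b + 1)))) {-1..1}" .
  moreover have c: "real b + 1 \<noteq> 0" using of_nat_0_le_iff[of b] by linarith
  moreover have "2 / c * (A / 2 * (2 * fa * (c * fb) / F)) = 2 * (A * fa) * fb / F" if "c \<noteq> 0" for A c fa fb F :: real
    using that by simp
  note this[OF c, of "real a + 1" "fact a" "fact b" "fact (Suc a + b + 1)"]
  moreover have "fact (Suc b) = (real b + 1) * fact b" "fact (Suc a) = (real a + 1) * fact a"
    "a + Suc b + 1 = Suc a + b + 1"
    by (simp_all add: algebra_simps)
  moreover have "2 / c * (c / 2 * X) = X" if "c \<noteq> 0" for c X :: real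
    using that by simp
  note this[OF c]
  ultimately show ?case by (simp only:)
qed

section \<open>The Taylor expansion transversal to the diagonal\<close>

definition shear :: "(complex \<times> complex \<Rightarrow> complex) \<Rightarrow> complex \<times> complex \<Rightarrow> complex" where
  "shear f = (\<lambda>(m, \<tau>). f (m + \<tau>, m - \<tau>))"

definition shear_dom :: "complex set \<Rightarrow> (complex \<times> complex) set" where
  "shear_dom D = {(m, \<tau>). m + \<tau> \<in> D \<and> m - \<tau> \<in> D}"

lemma open_shear_dom:
  assumes "open D" shows "open (shear_dom D)"
proof -
  have "shear_dom D = (\<lambda>p. fst p + snd p) -` D \<inter> (\<lambda>p. fst p - snd p) -` D"
    by (auto simp: shear_dom_def)
  then show ?thesis using assms by (auto intro!: open_Int open_vimage continuous_intros)
qed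

text \<open>The chain rule. The idle factors 1 keep the right-hand sides in the shape expected by
  \<open>pd_linear\<close> and \<open>holomorphic2_linear\<close>, so that the lemma can be applied
  a second time to the derivatives.\<close>

lemma shear_partials:
  assumes D: "open D" and f: "f holomorphic2_on (D \<times> D)"
  shows "shear f holomorphic2_on shear_dom D"
    and "p \<in> shear_dom D \<Longrightarrow> pd1 (shear f) p = shear (\<lambda>q. 1 * pd1 f q + 1 * pd2 f q) p"
    and "p \<in> shear_dom D \<Longrightarrow> pd2 (shear f) p = shear (\<lambda>q. 1 * pd1 f q + (- 1) * pd2 f q) p"
proof -
  have *: "(shear f has_derivative (\<lambda>h. (1 * pd1 f (m + t, m - t) + 1 * pd2 f (m + t, m - t)) * fst h
     + (1 * pd1 f (m + t, m - t) + (- 1) * pd2 f (m + t, m - t)) * snd h)) (at (m, t))"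
    if "(m, t) \<in> shear_dom D" for m t
  proof -
    let ?s = "\<lambda>p. (fst p + snd p, fst p - snd p)"
    have d: "(f has_derivative (\<lambda>h. pd1 f (m + t, m - t) * fst h + pd2 f (m + t, m - t) * snd h)) (at (?s (m, t)))"
      unfolding fst_conv snd_conv
      using that D f
      by (intro holomorphic2_on_imp_has_derivative[of "D \<times> D"]) (auto simp: open_Times shear_dom_def)
    have "(?s has_derivative (\<lambda>h. (fst h + snd h, fst h - snd h))) (at (m, t))"
      by (auto intro!: derivative_eq_intros)
    from has_derivative_compose[OF this d]
    show ?thesis by (simp add: shear_def case_prod_beta' algebra_simps)
  qed
  show "shear f holomorphic2_on shear_dom D"
    unfolding holomorphic2_on_def
  proof safe
    fix m t assume "(m, t) \<in> shear_dom D"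
    from has_derivative_at_withinI[OF *[OF this]]
    show "\<exists>a b. (shear f has_derivative (\<lambda>h. a * fst h + b * snd h)) (at (m, t) within shear_dom D)"
      by blast
  qed
  show "p \<in> shear_dom D \<Longrightarrow> pd1 (shear f) p = shear (\<lambda>q. 1 * pd1 f q + 1 * pd2 f q) p"
    using has_derivative_imp_partials(3)[OF *] by (cases p) (simp add: shear_def)
  show "p \<in> shear_dom D \<Longrightarrow> pd2 (shear f) p = shear (\<lambda>q. 1 * pd1 f q + (- 1) * pd2 f q) p"
    using has_derivative_imp_partials(4)[OF *] by (cases p) (simp add: shear_def)
qed

text \<open>With F = \<open>shear f\<close> one has x - y = 2 \<tau>, f_x - f_y = F_\<tau>, and, by
  symmetry of the mixed partials, 4 f_xy = F_mm - F_\<tau>\<tau>.\<close>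

lemma shear_PDE:
  assumes D: "open D" and f: "f holomorphic2_on (D \<times> D)"
    and P: "\<And>p. p \<in> D \<times> D \<Longrightarrow> P_op f p = - c * f p"
    and p: "(m, \<tau>) \<in> shear_dom D"
  shows "\<tau>\<^sup>2 * (pd1 (pd1 (shear f)) (m, \<tau>) - pd2 (pd2 (shear f)) (m, \<tau>))
    - 2 * \<tau> * pd2 (shear f) (m, \<tau>) + c * shear f (m, \<tau>) = 0"
proof -
  let ?S = "D \<times> D" and ?q = "(m + \<tau>, m - \<tau>)"
  have S: "open ?S" using D by (simp add: open_Times)
  have q: "?q \<in> ?S" using p by (auto simp: shear_dom_def)
  note h = holomorphic2_pd1[OF S f] holomorphic2_pd2[OF S f]
  note o = open_shear_dom[OF D]
  have "pd1 (pd1 (shear f)) (m, \<tau>) = pd1 (shear (\<lambda>q. 1 * pd1 f q + 1 * pd2 f q)) (m, \<tau>)"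
    by (rule pd1_cong[OF o p]) (rule shear_partials[OF D f])
  also have "\<dots> = pd1 (\<lambda>q. 1 * pd1 f q + 1 * pd2 f q) ?q + pd2 (\<lambda>q. 1 * pd1 f q + 1 * pd2 f q) ?q"
    using shear_partials(2)[OF D holomorphic2_linear[OF h] p, of 1 1] by (simp add: shear_def)
  also have "\<dots> = pd1 (pd1 f) ?q + 2 * pd1 (pd2 f) ?q + pd2 (pd2 f) ?q"
    using pd_linear[OF S h q, of 1 1] pd2_pd1_commute[OF S f q] by simp
  finally have 1: "pd1 (pd1 (shear f)) (m, \<tau>) = \<dots>" .
  have "pd2 (pd2 (shear f)) (m, \<tau>) = pd2 (shear (\<lambda>q. 1 * pd1 f q + (- 1) * pd2 f q)) (m, \<tau>)"
    by (rule pd2_cong[OF o p]) (rule shear_partials[OF D f])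
  also have "\<dots> = pd1 (\<lambda>q. 1 * pd1 f q + (- 1) * pd2 f q) ?q - pd2 (\<lambda>q. 1 * pd1 f q + (- 1) * pd2 f q) ?q"
    using shear_partials(3)[OF D holomorphic2_linear[OF h] p, of 1 "- 1"] by (simp add: shear_def)
  also have "\<dots> = pd1 (pd1 f) ?q - 2 * pd1 (pd2 f) ?q + pd2 (pd2 f) ?q"
    using pd_linear[OF S h q, of 1 "- 1"] pd2_pd1_commute[OF S f q] by simp
  finally have 2: "pd2 (pd2 (shear f)) (m, \<tau>) = \<dots>" .
  show ?thesis
    using P[OF q] unfolding 1 2 shear_partials(3)[OF D f p]
    by (simp add: P_op_def shear_def power2_eq_square algebra_simps)
qed

section \<open>Taylor coefficients in the transversal variable\<close>

lemma pd2_funpow: "(pd2 ^^ k) F (m, \<tau>) = (deriv ^^ k) (\<lambda>\<tau>. F (m, \<tau>)) \<tau>"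
proof (induction k arbitrary: \<tau>)
  case (Suc k)
  then have "(\<lambda>y'. (pd2 ^^ k) F (m, y')) = (deriv ^^ k) (\<lambda>\<tau>. F (m, \<tau>))" by (intro ext)
  then show ?case by (simp add: pd2_def[of "(pd2 ^^ k) F"])
qed simp

lemma holomorphic2_pd2_funpow: "open S \<Longrightarrow> F holomorphic2_on S \<Longrightarrow> (pd2 ^^ k) F holomorphic2_on S"
  by (induction k) (auto intro: holomorphic2_pd2)

text \<open>Hence the Taylor coefficients of F_mm in \<tau> are the second m-derivatives of those of
  F.\<close>

lemma pd2_funpow_pd1:
  assumes S: "open S" and F: "F holomorphic2_on S" and p: "p \<in> S"
  shows "(pd2 ^^ k) (pd1 F) p = pd1 ((pd2 ^^ k) F) p"
  using p
proof (induction k arbitrary: p)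
  case (Suc k)
  have "(pd2 ^^ Suc k) (pd1 F) p = pd2 (pd1 ((pd2 ^^ k) F)) p"
    using pd2_cong[OF S Suc.prems Suc.IH] by simp
  also have "\<dots> = pd1 (pd2 ((pd2 ^^ k) F)) p"
    by (rule pd2_pd1_commute[OF S holomorphic2_pd2_funpow[OF S F] Suc.prems])
  finally show ?case by simp
qed simp

lemma holomorphic2_slice:
  assumes "open S" "F holomorphic2_on S"
  shows "open {\<tau>. (m, \<tau>) \<in> S}" "(\<lambda>\<tau>. F (m, \<tau>)) holomorphic_on {\<tau>. (m, \<tau>) \<in> S}"
proof -
  have "open ((\<lambda>\<tau>. (m, \<tau>)) -` S)"
    using assms(1) by (intro open_vimage) (auto intro!: continuous_intros)
  then show "open {\<tau>. (m, \<tau>) \<in> S}" by (simp add: vimage_def)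
  then show "(\<lambda>\<tau>. F (m, \<tau>)) holomorphic_on {\<tau>. (m, \<tau>) \<in> S}"
    using holomorphic2_on_imp_DERIV(2)[OF assms] by (auto simp: holomorphic_on_open)
qed

text \<open>Frobenius recursion: the exponents of the equation at the diagonal are \<open>l\<close> and \<open>-l-1\<close>, so
  for \<open>k \<noteq> l\<close> the \<open>k\<close>-th Taylor coefficient in \<open>\<tau>\<close> is determined by the \<open>(k-2)\<close>-nd one.\<close>

lemma shear_taylor_recursion:
  assumes D: "open D" and f: "f holomorphic2_on (D \<times> D)"
    and P: "\<And>p. p \<in> D \<times> D \<Longrightarrow> P_op f p = - (of_nat l * (of_nat l + 1)) * f p" and m: "m \<in> D"
  shows "(of_nat k * (of_nat k + 1) - of_nat l * (of_nat l + 1)) * (pd2 ^^ k) (shear f) (m, 0) =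
    of_nat k * of_nat (k - 1) * pd1 (pd1 ((pd2 ^^ (k - 2)) (shear f))) (m, 0)"
proof -
  let ?F = "shear f" and ?S = "shear_dom D"
  let ?A = "{\<tau>. (m, \<tau>) \<in> ?S}"
  define \<phi> where "\<phi> = (\<lambda>\<tau>. ?F (m, \<tau>))"
  define \<psi> where "\<psi> = (\<lambda>\<tau>. pd1 (pd1 ?F) (m, \<tau>))"
  note S = open_shear_dom[OF D] and F = shear_partials(1)[OF D f]
  have m0: "(m, 0) \<in> ?S" using m by (simp add: shear_dom_def)
  have A: "open ?A" "0 \<in> ?A" and hol: "\<phi> holomorphic_on ?A" "\<psi> holomorphic_on ?A"
    using m0 holomorphic2_slice[OF S F] holomorphic2_slice[OF S holomorphic2_pd1[OF S holomorphic2_pd1[OF S F]]]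
    by (auto simp: \<phi>_def \<psi>_def)
  define \<Phi> \<Psi> where "\<Phi> = fps_expansion \<phi> 0" and "\<Psi> = fps_expansion \<psi> 0"
  have exp: "\<phi> has_fps_expansion \<Phi>" "\<psi> has_fps_expansion \<Psi>"
    unfolding \<Phi>_def \<Psi>_def using A hol by (auto intro: has_fps_expansion_fps_expansion)
  \<comment> \<open>With m fixed, the equation is an ordinary one in \<tau> with source F_mm. The
    factor X^2 in front of the source series shifts its index by 2.\<close>
  let ?G = "fps_X\<^sup>2 * \<Psi> - fps_X\<^sup>2 * fps_deriv (fps_deriv \<Phi>) - (fps_X * fps_deriv \<Phi> + fps_X * fps_deriv \<Phi>) + fps_const (of_nat l * (of_nat l + 1)) * \<Phi>"
  have "(\<lambda>\<tau>. \<tau>\<^sup>2 * \<psi> \<tau> - \<tau>\<^sup>2 * deriv (deriv \<phi>) \<tau> - (\<tau> * deriv \<phi> \<tau> + \<tau> * deriv \<phi> \<tau>) + (of_nat l * (of_nat l + 1)) * \<phi> \<tau>)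
     has_fps_expansion ?G"
    by (intro fps_expansion_intros exp)
  moreover have "eventually (\<lambda>\<tau>. \<tau>\<^sup>2 * \<psi> \<tau> - \<tau>\<^sup>2 * deriv (deriv \<phi>) \<tau> - (\<tau> * deriv \<phi> \<tau> + \<tau> * deriv \<phi> \<tau>) + (of_nat l * (of_nat l + 1)) * \<phi> \<tau> = 0) (nhds 0)"
    using eventually_nhds_in_open[OF A]
  proof eventually_elim
    case (elim \<tau>)
    have "deriv \<phi> = (\<lambda>\<tau>. pd2 ?F (m, \<tau>))" "deriv (deriv \<phi>) \<tau> = pd2 (pd2 ?F) (m, \<tau>)"
      by (simp_all add: \<phi>_def pd2_def)
    then show ?case
      using shear_PDE[OF D f P, of m \<tau>] elim by (simp add: \<phi>_def \<psi>_def algebra_simps)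
  qed
  ultimately have "(\<lambda>_. 0) has_fps_expansion ?G"
    by (subst (asm) has_fps_expansion_cong[OF _ refl]) auto
  then have "?G = 0"
    using has_fps_expansion_0 fps_expansion_unique_complex by blast
  then have "fps_nth ?G k = 0" by simp
  \<comment> \<open>The contributions k(k - 1) of X^2 \<Phi>'' and 2k of 2 X \<Phi>' add up to k(k +
    1).\<close>
  moreover have "fps_nth ?G k = (if k < 2 then 0 else fps_nth \<Psi> (k - 2))
     - (of_nat k * (of_nat k + 1) - of_nat l * (of_nat l + 1)) * fps_nth \<Phi> k"
    unfolding fps_sub_nth fps_add_nth
    by (cases k; cases "k - 1") (auto simp: fps_X_power_mult_nth algebra_simps numeral_2_eq_2)
  moreover have "fps_nth \<Phi> k = (pd2 ^^ k) ?F (m, 0) / fact k"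
    using fps_nth_fps_expansion[OF exp(1)] by (simp add: \<phi>_def pd2_funpow)
  moreover have "fps_nth \<Psi> (k - 2) = pd1 (pd1 ((pd2 ^^ (k - 2)) ?F)) (m, 0) / fact (k - 2)"
  proof -
    have "(pd2 ^^ (k - 2)) (pd1 (pd1 ?F)) (m, 0) = pd1 ((pd2 ^^ (k - 2)) (pd1 ?F)) (m, 0)"
      by (rule pd2_funpow_pd1[OF S holomorphic2_pd1[OF S F] m0])
    also have "\<dots> = pd1 (pd1 ((pd2 ^^ (k - 2)) ?F)) (m, 0)"
      by (rule pd1_cong[OF S m0]) (rule pd2_funpow_pd1[OF S F])
    finally show ?thesis using fps_nth_fps_expansion[OF exp(2)] by (simp add: \<psi>_def pd2_funpow)
  qed
  ultimately have *: "(of_nat k * (of_nat k + 1) - of_nat l * (of_nat l + 1)) * (pd2 ^^ k) (shear f) (m, 0)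
     = (if k < 2 then 0 else fact k * (pd1 (pd1 ((pd2 ^^ (k - 2)) ?F)) (m, 0) / fact (k - 2)))"
    by (auto simp: field_simps)
  \<comment> \<open>For k < 2 the truncated index k - 2 is harmless, since k(k - 1) = 0; otherwise
    k!/(k-2)! = k(k - 1).\<close>
  have "k < 2 \<or> (\<exists>j. k = Suc (Suc j))" by presburger
  then show ?thesis
    unfolding * by (auto simp: less_2_cases_iff)
qed

text \<open>Since k(k + 1) is strictly increasing, k = l is the only coefficient that the recursion
  leaves free. Once it vanishes, the whole Taylor series at the diagonal does, and the identity
  theorem carries this along each slice.\<close>

lemma Sol_kernel:
  assumes D: "open D" "convex D" and f: "f holomorphic2_on (D \<times> D)"
    and P: "\<And>p. p \<in> D \<times> D \<Longrightarrow> P_op f p = - (of_nat l * (of_nat l + 1)) * f p"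
    and 0: "\<And>m. m \<in> D \<Longrightarrow> (pd2 ^^ l) (shear f) (m, 0) = 0"
    and p: "p \<in> D \<times> D"
  shows "f p = 0"
proof -
  \<comment> \<open>All base points m are treated at once, because the recursion differentiates the
    earlier coefficient along the diagonal.\<close>
  have all: "(pd2 ^^ k) (shear f) (m, 0) = 0" if "m \<in> D" for k m
    using that
  proof (induction k arbitrary: m rule: less_induct)
    case (less k)
    show ?case
    proof (cases "k = l")
      case False
      have pd1_0: "pd1 G (m, 0) = 0" if "m \<in> D" "\<And>m. m \<in> D \<Longrightarrow> G (m, 0) = 0" for G m
      proof -
        have "deriv (\<lambda>m. G (m, 0)) m = deriv (\<lambda>m. 0) m"
          using eventually_nhds_in_open[OF D(1) that(1)]
          by (intro deriv_cong_ev) (auto elim!: eventually_mono simp: that(2))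
        then show ?thesis by (simp add: pd1_def)
      qed
      have "of_nat k * of_nat (k - 1) * pd1 (pd1 ((pd2 ^^ (k - 2)) (shear f))) (m, 0) = 0"
        by (cases "k < 2") (auto simp: less_2_cases_iff intro!: pd1_0 less)
      then have "(of_nat k * (of_nat k + 1) - of_nat l * (of_nat l + 1)) * (pd2 ^^ k) (shear f) (m, 0) = 0"
        using shear_taylor_recursion[OF D(1) f P less.prems, of k] by simp
      moreover have "(of_nat k * (of_nat k + 1) - of_nat l * (of_nat l + 1) :: complex) \<noteq> 0"
      proof -
        have "k * (k + 1) \<noteq> l * (l + 1)"
          using False mult_strict_mono[of k l "k + 1" "l + 1"] mult_strict_mono[of l k "l + 1" "k + 1"] by linarith
        then have "of_nat (k * (k + 1)) - of_nat (l * (l + 1)) \<noteq> (0 :: complex)"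
          unfolding right_minus_eq of_nat_eq_iff .
        then show ?thesis by (simp only: of_nat_mult of_nat_add of_nat_1 not_False_eq_True)
      qed
      ultimately show ?thesis by simp
    qed (use 0 less.prems in simp)
  qed
  obtain x y where xy: "p = (x, y)" "x \<in> D" "y \<in> D" using p by auto
  define m \<tau> where "m = (x + y) / 2" and "\<tau> = (x - y) / 2"
  have mt: "m + \<tau> = x" "m - \<tau> = y"
    by (simp_all add: m_def \<tau>_def field_simps)
  let ?A = "{\<tau>. (m, \<tau>) \<in> shear_dom D}"
  have "m = (1/2) *\<^sub>R x + (1/2) *\<^sub>R y"
    by (simp add: m_def scaleR_conv_of_real field_simps)
  then have m: "m \<in> D" using convexD[OF D(2) xy(2,3), of "1/2" "1/2"] by simp
  \<comment> \<open>The slice is the intersection of D - m and m - D, hence convex; this gives the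
    connectedness for the identity theorem.\<close>
  have "convex ?A"
  proof (rule convexI)
    fix a b and u v :: real assume *: "a \<in> ?A" "b \<in> ?A" "0 \<le> u" "0 \<le> v" "u + v = 1"
    have "m + (u *\<^sub>R a + v *\<^sub>R b) = u *\<^sub>R (m + a) + v *\<^sub>R (m + b)"
      "m - (u *\<^sub>R a + v *\<^sub>R b) = u *\<^sub>R (m - a) + v *\<^sub>R (m - b)"
      using scaleR_left_distrib[of u v m] *(5) by (simp_all add: scaleR_right_distrib scaleR_diff_right)
    then show "u *\<^sub>R a + v *\<^sub>R b \<in> ?A"
      using * D(2) by (simp add: shear_dom_def convexD)
  qed
  have "shear f (m, \<tau>) = 0"
    by (rule holomorphic_fun_eq_0_on_connected[of _ ?A 0])
       (use holomorphic2_slice[OF open_shear_dom[OF D(1)] shear_partials(1)[OF D(1) f], of m] \<open>convex ?A\<close> m mt xy all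
         in \<open>auto simp: convex_connected shear_dom_def simp flip: pd2_funpow\<close>)
  then show ?thesis using mt xy(1) by (simp add: shear_def)
qed


section \<open>Normalisation and surjectivity of the integral operator\<close>

lemma has_integral_gegenbauer_weight:
  "((\<lambda>v. gegenbauer_weight l v * of_real (((1 - v) / 2) ^ a * ((1 + v) / 2) ^ b)) has_integral
     (2 * 4 ^ l * fact (l + a) * fact (l + b) / fact (2 * l + a + b + 1))) {-1..1}"
proof -
  have "(\<lambda>v. gegenbauer_weight l v * of_real (((1 - v) / 2) ^ a * ((1 + v) / 2) ^ b)) =
    (\<lambda>v. 4 ^ l * of_real (((1 - v) / 2) ^ (l + a) * ((1 + v) / 2) ^ (l + b)))"
  proof
    fix v :: real
    \<comment> \<open>This factorisation shifts both exponents of the Beta integral by l and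
      produces the constant 4^l.\<close>
    have "1 - v\<^sup>2 = 4 * (((1 - v) / 2) * ((1 + v) / 2))"
      by (simp add: field_simps power2_eq_square)
    then have "(1 - v\<^sup>2) ^ l = 4 ^ l * (((1 - v) / 2) ^ l * ((1 + v) / 2) ^ l)"
      by (metis power_mult_distrib)
    then show "gegenbauer_weight l v * of_real (((1 - v) / 2) ^ a * ((1 + v) / 2) ^ b) =
      4 ^ l * of_real (((1 - v) / 2) ^ (l + a) * ((1 + v) / 2) ^ (l + b))"
      by (simp add: gegenbauer_weight_def power_add mult_ac del: power_divide)
  qed
  moreover have "fact (2 * l + a + b + 1) = (fact (l + a + (l + b) + 1) :: complex)"
    by (rule arg_cong[of _ _ fact]) simp
  ultimately show ?thesis
    using has_integral_mult_right[OF has_integral_of_real[OF integral_chord_weights[of "l + a" "l + b"]], of "4 ^ l :: complex"]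
    by (simp only: of_real_mult of_real_divide of_real_fact of_real_numeral times_divide_eq_right mult_ac)
qed

text \<open>The total mass of the weight, 2 * 4^l B(l+1, l+1).\<close>

definition gegenbauer_norm :: "nat \<Rightarrow> complex" where
  "gegenbauer_norm l = 2 * 4 ^ l * (fact l)\<^sup>2 / fact (2 * l + 1)"

lemma chord_int_diagonal: "chord_int g (gegenbauer_weight l) (m, m) = gegenbauer_norm l * g m"
proof -
  have "chord_point (m, m) v = m" for v
    by (simp add: chord_point_def)
  then have "((\<lambda>v. g (chord_point (m, m) v) * gegenbauer_weight l v) has_integral gegenbauer_norm l * g m) {-1..1}"
    using has_integral_mult_right[OF has_integral_gegenbauer_weight[of l 0 0], of "g m"]
    by (simp add: gegenbauer_norm_def power2_eq_square mult_ac del: fact_Suc)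
  then show ?thesis
    unfolding chord_int_def by (rule integral_unique)
qed

text \<open>On a slice the function is (2 \<tau>)^l H(\<tau>) with H holomorphic at 0, and H(0) is
  the integral over a degenerate chord, i.e. g(m) times the mass of the weight. The factor l! turns
  the coefficient into a derivative.\<close>

lemma Psi_leading_coeff:
  assumes D: "convex D" "open D" and g: "g holomorphic_on D" and m: "m \<in> D"
  shows "(pd2 ^^ l) (shear (Psi D l g)) (m, 0) = fact l * 2 ^ l * gegenbauer_norm l * g m"
proof -
  let ?A = "{\<tau>. (m, \<tau>) \<in> shear_dom D}"
  define H where "H = (\<lambda>\<tau>. shear (chord_int g (gegenbauer_weight l)) (m, \<tau>))"
  note sl = holomorphic2_slice[OF open_shear_dom[OF D(2)] shear_partials(1)[OF D(2)
      chord_int_holomorphic2[OF D g continuous_on_gegenbauer_weight]], where m = m]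
  have A: "open ?A" "0 \<in> ?A" and H: "H holomorphic_on ?A"
    using sl m unfolding H_def by (auto simp: shear_dom_def)
  have H': "H has_fps_expansion fps_expansion H 0"
    using A H by (rule has_fps_expansion_fps_expansion)
  have "(\<lambda>\<tau>. 2 ^ l * (\<tau> ^ l * H \<tau>)) has_fps_expansion fps_const (2 ^ l) * (fps_X ^ l * fps_expansion H 0)"
    by (intro fps_expansion_intros H')
  moreover have "eventually (\<lambda>\<tau>. 2 ^ l * (\<tau> ^ l * H \<tau>) = shear (Psi D l g) (m, \<tau>)) (nhds 0)"
    using eventually_nhds_in_open[OF A]
  proof eventually_elim
    case (elim \<tau>)
    then have "Psi D l g (m + \<tau>, m - \<tau>) = (2 * \<tau>) ^ l * H \<tau>"
      by (subst Psi_eq) (auto simp: shear_dom_def H_def shear_def)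
    then show ?case by (simp add: shear_def power_mult_distrib)
  qed
  ultimately have "(\<lambda>\<tau>. shear (Psi D l g) (m, \<tau>)) has_fps_expansion fps_const (2 ^ l) * (fps_X ^ l * fps_expansion H 0)"
    by (subst (asm) has_fps_expansion_cong[OF _ refl]) auto
  from fps_nth_fps_expansion[OF this, of l]
  have "2 ^ l * fps_nth (fps_expansion H 0) 0 = (deriv ^^ l) (\<lambda>\<tau>. shear (Psi D l g) (m, \<tau>)) 0 / fact l"
    by (simp add: fps_X_power_mult_nth)
  moreover have "fps_nth (fps_expansion H 0) 0 = gegenbauer_norm l * g m"
    using fps_nth_fps_expansion[OF H', of 0] by (simp add: H_def shear_def chord_int_diagonal)
  ultimately show ?thesis by (simp add: pd2_funpow field_simps)
qed

text \<open>The candidate g is the l-th transversal derivative of f on the diagonal, divided by the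
  constant that \<open>Psi\<close> produces there. The difference f - \<open>Psi D l g\<close> is a
  solution with vanishing l-th coefficient, hence zero.\<close>

lemma Sol_imp_Psi:
  assumes D: "convex D" "open D" and f: "f \<in> Sol D l"
  shows "\<exists>g\<in>Hol D. f = Psi D l g"
proof
  let ?S = "D \<times> D"
  have S: "open ?S" using D by (simp add: open_Times)
  have f2: "f holomorphic2_on ?S" and Pf: "\<And>p. p \<in> ?S \<Longrightarrow> P_op f p = - (of_nat l * (of_nat l + 1)) * f p"
    and fe: "f \<in> extensional ?S"
    using f by (auto simp: Sol_def Hol2_def)
  define c where "c = fact l * 2 ^ l * gegenbauer_norm l"
  have "c \<noteq> 0" by (simp add: c_def gegenbauer_norm_def del: fact_Suc)
  let ?G = "(pd2 ^^ l) (shear f)"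
  define g where "g = (\<lambda>m\<in>D. ?G (m, 0) / c)"
  have "?G holomorphic2_on shear_dom D"
    by (intro holomorphic2_pd2_funpow shear_partials open_shear_dom D f2)
  then have "((\<lambda>m. ?G (m, 0)) has_field_derivative pd1 ?G (m, 0)) (at m)" if "m \<in> D" for m
    using that by (intro holomorphic2_on_imp_DERIV[OF open_shear_dom[OF D(2)]]) (auto simp: shear_dom_def)
  then have "(\<lambda>m. ?G (m, 0)) holomorphic_on D"
    using D(2) by (auto simp: holomorphic_on_open)
  then have "(\<lambda>m. ?G (m, 0) / c) holomorphic_on D"
    using \<open>c \<noteq> 0\<close> by (intro holomorphic_intros) auto
  then have g: "g holomorphic_on D"
    by (rule holomorphic_transform) (simp add: g_def)
  then show "g \<in> Hol D" by (simp add: Hol_def g_def)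
  have h: "Psi D l g \<in> Sol D l" by (rule Psi_in_Sol[OF D g])
  let ?h = "Psi D l g"
  have h2: "?h holomorphic2_on ?S" and Ph: "\<And>p. p \<in> ?S \<Longrightarrow> P_op ?h p = - (of_nat l * (of_nat l + 1)) * ?h p"
    and he: "?h \<in> extensional ?S"
    using h by (auto simp: Sol_def Hol2_def)
  define d where "d = (\<lambda>q. 1 * f q + (- 1) * ?h q)"
  have d2: "d holomorphic2_on ?S"
    unfolding d_def by (intro holomorphic2_linear f2 h2)
  have Pd: "P_op d p = - (of_nat l * (of_nat l + 1)) * d p" if p: "p \<in> ?S" for p
  proof -
    have "pd1 (pd2 d) p = pd1 (\<lambda>q. 1 * pd2 f q + (- 1) * pd2 ?h q) p"
      unfolding d_def by (rule pd1_cong[OF S p]) (rule pd_linear[OF S f2 h2])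
    also have "\<dots> = 1 * pd1 (pd2 f) p + (- 1) * pd1 (pd2 ?h) p"
      by (intro pd_linear[OF S] holomorphic2_pd2 S f2 h2 p)
    finally have "pd1 (pd2 d) p = pd1 (pd2 f) p - pd1 (pd2 ?h) p" by simp
    moreover have "pd1 d p = pd1 f p - pd1 ?h p" "pd2 d p = pd2 f p - pd2 ?h p"
      using pd_linear[OF S f2 h2 p, of 1 "- 1", folded d_def] by simp_all
    ultimately have "P_op d p = P_op f p - P_op ?h p"
      by (cases p) (simp add: P_op_def right_diff_distrib)
    then show ?thesis using Pf[OF p] Ph[OF p] by (simp add: d_def algebra_simps)
  qed
  have d0: "(pd2 ^^ l) (shear d) (m, 0) = 0" if m: "m \<in> D" for m
  proof -
    note sl = holomorphic2_slice[OF open_shear_dom[OF D(2)] shear_partials(1)[OF D(2)]]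
    have "(deriv ^^ l) (\<lambda>\<tau>. shear f (m, \<tau>) - shear ?h (m, \<tau>)) 0
       = (deriv ^^ l) (\<lambda>\<tau>. shear f (m, \<tau>)) 0 - (deriv ^^ l) (\<lambda>\<tau>. shear ?h (m, \<tau>)) 0"
      by (rule higher_deriv_diff[OF sl(2)[OF f2] sl(2)[OF h2] sl(1)[OF f2]])
         (use m in \<open>simp add: shear_dom_def\<close>)
    also have "\<dots> = ?G (m, 0) - c * g m"
      using Psi_leading_coeff[OF D g m, of l] by (simp add: pd2_funpow c_def)
    also have "\<dots> = 0" using m \<open>c \<noteq> 0\<close> by (simp add: g_def)
    finally show ?thesis by (simp add: pd2_funpow d_def shear_def)
  qed
  show "f = ?h"
  proof
    fix p
    show "f p = ?h p"
    proof (cases "p \<in> ?S")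
      case True
      from Sol_kernel[OF D(2,1) d2 Pd d0 True] show ?thesis by (simp add: d_def)
    next
      case False
      show ?thesis unfolding extensional_arb[OF fe False] extensional_arb[OF he False] ..
    qed
  qed
qed

section \<open>The contour integral operator\<close>

text \<open>The zero in y of the denominator (x - z)(y - z) + t (x - y).\<close>

definition T_pole :: "complex \<Rightarrow> complex \<Rightarrow> complex \<Rightarrow> complex" where
  "T_pole z t x = z - t * (x - z) / (x - z - t)"

text \<open>The condition 2|t| < r gives |x - z - t| \<ge> r - |t| > |t|, which places the pole at
  distance |t| r / |x - z - t| < r from z.\<close>

lemma T_pole_facts:
  assumes t: "2 * norm t < r" and x: "x \<in> sphere z r"
  shows "r - norm t \<le> norm (x - z - t)" "x - z - t \<noteq> 0" "T_pole z t x \<in> ball z r"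
    "x - T_pole z t x = (x - z)\<^sup>2 / (x - z - t)"
    "(x - z) * (y - z) + t * (x - y) = (x - z - t) * (y - T_pole z t x)"
proof -
  have nx: "norm (x - z) = r" using x by (simp add: dist_norm norm_minus_commute)
  have r: "0 < r" using t norm_ge_zero[of t] by linarith
  show le: "r - norm t \<le> norm (x - z - t)" using norm_triangle_ineq2[of "x - z" t] nx by simp
  then have pos: "norm t < norm (x - z - t)" using t by linarith
  then show ne: "x - z - t \<noteq> 0" using norm_ge_zero[of t] by (metis norm_zero not_less)
  have "norm t * r / norm (x - z - t) < r"
    using mult_strict_right_mono[OF pos r] ne by (simp add: divide_simps mult.commute)
  then show "T_pole z t x \<in> ball z r"
    by (simp add: T_pole_def dist_norm norm_divide norm_mult nx)
  show "x - T_pole z t x = (x - z)\<^sup>2 / (x - z - t)"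
    using ne by (simp add: T_pole_def field_simps power2_eq_square)
  have "(x - z - t) * (y - T_pole z t x) = (x - z - t) * (y - z) + t * (x - z)"
    using ne by (simp add: T_pole_def field_simps)
  then show "(x - z) * (y - z) + t * (x - y) = (x - z - t) * (y - T_pole z t x)"
    by (simp add: algebra_simps)
qed

lemma T_circ_eq_single_integral:
  assumes t: "2 * norm t < r" and f: "\<And>x. x \<in> sphere z r \<Longrightarrow> (\<lambda>y. f (x, y)) holomorphic_on cball z r"
  shows "T_circ r f (z, t) =
    1 / (2 * of_real pi * \<i>) * contour_integral (circlepath z r) (\<lambda>x. f (x, T_pole z t x) / (x - z - t))"
proof -
  have r: "0 < r" using t norm_ge_zero[of t] by linarith
  have inner: "contour_integral (circlepath z r) (\<lambda>y. f (x, y) / ((x - z) * (y - z) + t * (x - y)))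
    = 2 * of_real pi * \<i> * (f (x, T_pole z t x) / (x - z - t))" if x: "x \<in> sphere z r" for x
  proof -
    have "((\<lambda>y. f (x, y) / (y - T_pole z t x)) has_contour_integral (2 * of_real pi * \<i> * f (x, T_pole z t x))) (circlepath z r)"
      using T_pole_facts(3)[OF t x] f[OF x]
      by (intro Cauchy_integral_circlepath)
         (auto simp: dist_norm norm_minus_commute intro: holomorphic_on_imp_continuous_on holomorphic_on_subset)
    from has_contour_integral_div[OF this, of "x - z - t"] show ?thesis
      unfolding T_pole_facts(5)[OF t x] by (intro contour_integral_unique) (simp add: mult.commute)
  qed
  have "T_circ r f (z, t) = 1 / (2 * of_real pi * \<i>)\<^sup>2 * contour_integral (circlepath z r)
      (\<lambda>x. 2 * of_real pi * \<i> * (f (x, T_pole z t x) / (x - z - t)))"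
    unfolding T_circ_def split using r inner by (subst contour_integral_eq) auto
  also have "\<dots> = 1 / (2 * of_real pi * \<i>)\<^sup>2 * (2 * of_real pi * \<i> * contour_integral (circlepath z r)
      (\<lambda>x. f (x, T_pole z t x) / (x - z - t)))"
    by (simp add: contour_integral_integral mult.assoc flip: integral_mult_right)
  finally show ?thesis by (simp add: power2_eq_square)
qed

section \<open>Contour integrals of monomials\<close>

lemma higher_deriv_power_fact:
  "(deriv ^^ k) (\<lambda>w. (w - z) ^ (m + k)) w = fact (m + k) / fact m * (w - z :: complex) ^ m"
proof -
  have "(fact (m + k) :: complex) = fact m * pochhammer (1 + of_nat m) k"
    by (simp add: pochhammer_fact pochhammer_product'[symmetric])
  then show ?thesis by (simp add: higher_deriv_power Suc_diff_le)
qed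

text \<open>Both x - \<open>T_pole z t x\<close> and \<open>T_pole z t x\<close> - z are monomials
  in x - z over x - z - t. The integrand is therefore (-t)^k (x - z)^(2l+j+k) / (x - z - t)^(l+k+1),
  with a single pole at z + t inside the circle.\<close>

lemma contour_integral_monomial:
  assumes t: "2 * norm t < r"
  shows "((\<lambda>x. (x - T_pole z t x) ^ l * ((x - z) ^ j * (T_pole z t x - z) ^ k) / (x - z - t)) has_contour_integral
    2 * of_real pi * \<i> * ((- t) ^ k * t ^ (l + j) * (fact (2 * l + j + k) / (fact (l + k) * fact (l + j)))))
    (circlepath z r)"
proof -
  have r: "0 < r" and tr: "norm t < r" using t norm_ge_zero[of t] by linarith+
  \<comment> \<open>The exponent is split so that the l + k differentiations leave the power l + j,
    evaluated at x - z = t.\<close>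
  have "((\<lambda>x. (x - z) ^ ((l + j) + (l + k)) / (x - (z + t)) ^ Suc (l + k)) has_contour_integral
    of_real (2 * pi) * \<i> / fact (l + k) * (deriv ^^ (l + k)) (\<lambda>x. (x - z) ^ ((l + j) + (l + k))) (z + t)) (circlepath z r)"
    by (intro Cauchy_has_contour_integral_higher_derivative_circlepath continuous_intros holomorphic_intros)
       (use tr in \<open>simp add: dist_norm\<close>)
  then have "((\<lambda>x. (- t) ^ k * ((x - z) ^ ((l + j) + (l + k)) / (x - (z + t)) ^ Suc (l + k))) has_contour_integral
    (- t) ^ k * (2 * of_real pi * \<i> / fact (l + k) * (fact ((l + j) + (l + k)) / fact (l + j) * t ^ (l + j)))) (circlepath z r)"
    unfolding higher_deriv_power_fact of_real_mult of_real_numeral by (intro has_contour_integral_lmul) simp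
  then have "((\<lambda>x. (x - T_pole z t x) ^ l * ((x - z) ^ j * (T_pole z t x - z) ^ k) / (x - z - t)) has_contour_integral
    (- t) ^ k * (2 * of_real pi * \<i> / fact (l + k) * (fact ((l + j) + (l + k)) / fact (l + j) * t ^ (l + j)))) (circlepath z r)"
  proof (rule has_contour_integral_eq)
    fix x assume "x \<in> path_image (circlepath z r)"
    then have x: "x \<in> sphere z r" using r by simp
    have s: "T_pole z t x - z = (- t) * (x - z) / (x - z - t)"
      by (simp add: T_pole_def)
    show "(- t) ^ k * ((x - z) ^ ((l + j) + (l + k)) / (x - (z + t)) ^ Suc (l + k)) =
        (x - T_pole z t x) ^ l * ((x - z) ^ j * (T_pole z t x - z) ^ k) / (x - z - t)"
      unfolding T_pole_facts(4)[OF t x] s diff_diff_eq[symmetric] power_divide power_mult_distrib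
      by (simp add: power_add power2_eq_square power_mult_distrib mult_ac)
  qed
  moreover have "(l + j) + (l + k) = 2 * l + j + k" by simp
  ultimately show ?thesis by (simp add: mult_ac)
qed

text \<open>On the chord, w - z is the convex combination of x - z and y - z with coefficients (1 -
  v)/2 and (1 + v)/2; the binomial theorem leaves one Beta integral per term.\<close>

lemma chord_int_monomial:
  "chord_int (\<lambda>w. (w - z) ^ n) (gegenbauer_weight l) (x, y) =
    (\<Sum>j\<le>n. of_nat (n choose j) * ((x - z) ^ j * (y - z) ^ (n - j)) *
       (2 * 4 ^ l * fact (l + j) * fact (l + (n - j)) / fact (2 * l + n + 1)))"
proof -
  have "((\<lambda>v. \<Sum>j\<le>n. of_nat (n choose j) * ((x - z) ^ j * (y - z) ^ (n - j)) *
       (gegenbauer_weight l v * of_real (((1 - v) / 2) ^ j * ((1 + v) / 2) ^ (n - j)))) has_integral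
    (\<Sum>j\<le>n. of_nat (n choose j) * ((x - z) ^ j * (y - z) ^ (n - j)) *
       (2 * 4 ^ l * fact (l + j) * fact (l + (n - j)) / fact (2 * l + n + 1)))) {-1..1}"
  proof (intro has_integral_sum has_integral_mult_right)
    fix j assume "j \<in> {..n}"
    then have "2 * l + j + (n - j) + 1 = 2 * l + n + 1" by simp
    with has_integral_gegenbauer_weight[of l j "n - j"]
    show "((\<lambda>v. gegenbauer_weight l v * of_real (((1 - v) / 2) ^ j * ((1 + v) / 2) ^ (n - j))) has_integral
        (2 * 4 ^ l * fact (l + j) * fact (l + (n - j)) / fact (2 * l + n + 1))) {-1..1}"
      by (simp only:)
  qed simp
  moreover have "(\<Sum>j\<le>n. of_nat (n choose j) * ((x - z) ^ j * (y - z) ^ (n - j)) *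
       (gegenbauer_weight l v * of_real (((1 - v) / 2) ^ j * ((1 + v) / 2) ^ (n - j))))
     = (chord_point (x, y) v - z) ^ n * gegenbauer_weight l v" for v
  proof -
    have "chord_point (x, y) v - z = (x - z) * of_real ((1 - v) / 2) + (y - z) * of_real ((1 + v) / 2)"
      by (simp add: chord_point_def field_simps)
    then show ?thesis
      by (simp add: binomial_ring sum_distrib_left power_mult_distrib mult_ac del: of_real_divide)
  qed
  ultimately show ?thesis
    unfolding chord_int_def by (simp add: integral_unique)
qed

text \<open>Each monomial contributes \<open>t\<^sup>l (t - t)\<^sup>n\<close>, so only the constant term survives.\<close>

lemma contour_integral_chord_monomial:
  assumes t: "2 * norm t < r"
  shows "((\<lambda>x. (x - T_pole z t x) ^ l * chord_int (\<lambda>w. (w - z) ^ n) (gegenbauer_weight l) (x, T_pole z t x) / (x - z - t))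
    has_contour_integral 2 * of_real pi * \<i> * (2 * 4 ^ l / (2 * of_nat l + of_nat n + 1) * t ^ l * 0 ^ n)) (circlepath z r)"
proof -
  define C where "C j = (2 * 4 ^ l * fact (l + j) * fact (l + (n - j)) / fact (2 * l + n + 1) :: complex)" for j
  have "((\<lambda>x. \<Sum>j\<le>n. of_nat (n choose j) * C j *
      ((x - T_pole z t x) ^ l * ((x - z) ^ j * (T_pole z t x - z) ^ (n - j)) / (x - z - t)))
    has_contour_integral (\<Sum>j\<le>n. of_nat (n choose j) * C j * (2 * of_real pi * \<i> * ((- t) ^ (n - j) * t ^ (l + j)
        * (fact (2 * l + j + (n - j)) / (fact (l + (n - j)) * fact (l + j))))))) (circlepath z r)"
    by (intro has_contour_integral_sum has_contour_integral_lmul contour_integral_monomial t) simp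
  moreover have "(\<Sum>j\<le>n. of_nat (n choose j) * C j *
      ((x - T_pole z t x) ^ l * ((x - z) ^ j * (T_pole z t x - z) ^ (n - j)) / (x - z - t)))
    = (x - T_pole z t x) ^ l * chord_int (\<lambda>w. (w - z) ^ n) (gegenbauer_weight l) (x, T_pole z t x) / (x - z - t)" for x
    by (simp add: chord_int_monomial C_def sum_distrib_left sum_divide_distrib mult_ac)
  moreover have "(\<Sum>j\<le>n. of_nat (n choose j) * C j * (2 * of_real pi * \<i> * ((- t) ^ (n - j) * t ^ (l + j)
        * (fact (2 * l + j + (n - j)) / (fact (l + (n - j)) * fact (l + j))))))
    = 2 * of_real pi * \<i> * (2 * 4 ^ l / (2 * of_nat l + of_nat n + 1) * t ^ l * 0 ^ n)"
  proof -
    have "of_nat (n choose j) * C j * (2 * of_real pi * \<i> * ((- t) ^ (n - j) * t ^ (l + j)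
        * (fact (2 * l + j + (n - j)) / (fact (l + (n - j)) * fact (l + j)))))
      = 2 * of_real pi * \<i> * (2 * 4 ^ l / (2 * of_nat l + of_nat n + 1) * t ^ l) *
          (of_nat (n choose j) * t ^ j * (- t) ^ (n - j))" if "j \<le> n" for j
    proof -
      \<comment> \<open>Here \<open>f1\<close>, \<open>f2\<close>, \<open>F\<close> stand for
        (l+j)!, (l+n-j)!, (2l+n)!. The surviving denominator \<open>d\<close> = 2l+n+1 does not
        depend on j, so what remains is a pure binomial sum.\<close>
      have alg: "b * (c * f1 * f2 / (d * F)) * (p * (s * (tl * tj) * (F / (f2 * f1)))) = p * (c / d * tl) * (b * tj * s)"
        if "f1 \<noteq> 0" "f2 \<noteq> 0" "F \<noteq> 0" for b c f1 f2 d F p s tl tj :: complex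
        using that by simp
      have e: "2 * l + j + (n - j) = 2 * l + n" using that by simp
      have F: "fact (2 * l + n + 1) = (2 * of_nat l + of_nat n + 1) * (fact (2 * l + n) :: complex)"
        by (simp add: algebra_simps)
      show ?thesis
        unfolding C_def e F power_add by (rule alg) simp_all
    qed
    then have "(\<Sum>j\<le>n. of_nat (n choose j) * C j * (2 * of_real pi * \<i> * ((- t) ^ (n - j) * t ^ (l + j)
        * (fact (2 * l + j + (n - j)) / (fact (l + (n - j)) * fact (l + j))))))
      = (\<Sum>j\<le>n. 2 * of_real pi * \<i> * (2 * 4 ^ l / (2 * of_nat l + of_nat n + 1) * t ^ l) *
          (of_nat (n choose j) * t ^ j * (- t) ^ (n - j)))"
      by (intro sum.cong) auto
    also have "\<dots> = 2 * of_real pi * \<i> * (2 * 4 ^ l / (2 * of_nat l + of_nat n + 1) * t ^ l) * (t + (- t)) ^ n"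
      unfolding binomial_ring sum_distrib_left ..
    finally show ?thesis by simp
  qed
  ultimately show ?thesis by (simp only:)
qed

text \<open>The weight is at most 1 on an interval of length 2. Uniform convergence of Taylor
  polynomials on a disc thus passes to their chord integrals.\<close>

lemma chord_int_diff_bound:
  assumes C: "convex C" "continuous_on C g" "continuous_on C h" and b: "\<And>w. w \<in> C \<Longrightarrow> norm (g w - h w) \<le> B"
    and p: "p \<in> C \<times> C"
  shows "norm (chord_int g (gegenbauer_weight l) p - chord_int h (gegenbauer_weight l) p) \<le> 2 * B"
proof -
  note cw = continuous_on_gegenbauer_weight[of "{-1..1}" l]
  have "continuous_on C (\<lambda>w. g w - h w)" using C by (intro continuous_intros)
  note int = chord_integrable[OF C(1) this cw p]
  have "chord_int g (gegenbauer_weight l) p - chord_int h (gegenbauer_weight l) p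
    = integral {-1..1} (\<lambda>v. (g (chord_point p v) - h (chord_point p v)) * gegenbauer_weight l v)"
    unfolding chord_int_def left_diff_distrib
    by (rule integral_diff[symmetric]; rule chord_integrable[OF C(1) _ cw p]; fact)
  also have "norm \<dots> \<le> integral {-1..1} (\<lambda>v::real. B)"
  proof (rule integral_norm_bound_integral[OF int])
    fix v :: real assume v: "v \<in> {-1..1}"
    have "v\<^sup>2 \<le> 1" using v by (simp add: abs_square_le_1 abs_le_iff)
    then have "norm (gegenbauer_weight l v) \<le> 1"
      unfolding gegenbauer_weight_def norm_of_real by (simp add: power_abs power_le_one)
    moreover have "norm (g (chord_point p v) - h (chord_point p v)) \<le> B"
      by (rule b[OF chord_point_in[OF C(1) p v]])
    ultimately show "norm ((g (chord_point p v) - h (chord_point p v)) * gegenbauer_weight l v) \<le> B"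
      unfolding norm_mult using mult_mono[of _ B _ 1] norm_ge_zero order_trans
      by (metis mult.right_neutral)
  qed (rule integrable_const_ivl)
  also have "\<dots> = 2 * B" by simp
  finally show ?thesis .
qed

text \<open>The larger radius R makes the Taylor series converge uniformly on the closed disc of
  radius r, which by convexity contains every chord from a point of the circle to its pole. So the
  contour integral can be taken term by term.\<close>

lemma contour_integral_chord:
  assumes t: "2 * norm t < r" and R: "r < R" and g: "g holomorphic_on ball z R"
  shows "contour_integral (circlepath z r)
      (\<lambda>x. (x - T_pole z t x) ^ l * chord_int g (gegenbauer_weight l) (x, T_pole z t x) / (x - z - t))
    = 2 * of_real pi * \<i> * (2 * 4 ^ l / (2 * of_nat l + 1) * t ^ l * g z)"
proof -
  have r: "0 < r" and tr: "norm t < r" using t norm_ge_zero[of t] by linarith+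
  define a where "a n = (deriv ^^ n) g z / fact n" for n
  define s where "s N w = (\<Sum>n<N. a n * (w - z) ^ n)" for N w
  define K where "K h x = (x - T_pole z t x) ^ l * chord_int h (gegenbauer_weight l) (x, T_pole z t x) / (x - z - t)" for h x
  have sums: "(\<lambda>n. a n * (w - z) ^ n) sums g w" if "w \<in> ball z R" for w
    unfolding a_def by (rule holomorphic_power_series[OF g that])
  have "ereal r < conv_radius a"
  proof -
    \<comment> \<open>Convergence at one point at distance q > r from z already bounds the radius of
      convergence strictly above r.\<close>
    define q where "q = (r + R) / 2"
    have q: "r < q" "q < R" "0 < q" using R r by (simp_all add: q_def)
    have "z + of_real q \<in> ball z R" using q by (simp add: dist_norm)
    from sums_summable[OF sums[OF this]] have "summable (\<lambda>n. a n * of_real q ^ n)" by simp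
    from conv_radius_geI[OF this] have "ereal q \<le> conv_radius a"
      unfolding norm_of_real abs_of_pos[OF q(3)] .
    moreover have "ereal r < ereal q" using q(1) by simp
    ultimately show ?thesis by (rule less_le_trans[rotated])
  qed
  from powser_uniform_limit[OF this, of z]
  have lim: "uniform_limit (cball z r) s g sequentially"
    using sums R by (subst uniform_limit_cong'[where g = "\<lambda>N w. \<Sum>n<N. a n * (w - z) ^ n" and i = "\<lambda>w. \<Sum>n. a n * (w - z) ^ n"])
       (auto simp: s_def sums_iff)
  have cg: "continuous_on (cball z r) g"
    by (rule continuous_on_subset[OF holomorphic_on_imp_continuous_on[OF g]]) (use R in auto)
  have cs: "continuous_on (cball z r) (s N)" for N
    unfolding s_def by (intro continuous_intros)
  have ulim: "uniform_limit (sphere z r) (\<lambda>N. K (s N)) (K g) sequentially"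
  proof (rule uniform_limitI)
    fix e :: real assume e: "e > 0"
    \<comment> \<open>Bounds |(x - T_pole)^l / (x - z - t)|: the numerator's base is at most the
      diameter 2r, the denominator at least r - |t|. The tolerance e/(4M) then ends in e/2.\<close>
    define M where "M = (2 * r) ^ l / (r - norm t)"
    have M: "M > 0" using r tr by (simp add: M_def)
    have "eventually (\<lambda>N. \<forall>w\<in>cball z r. dist (s N w) (g w) < e / (4 * M)) sequentially"
      using uniform_limitD[OF lim, of "e / (4 * M)"] e M by simp
    then show "eventually (\<lambda>N. \<forall>x\<in>sphere z r. dist (K (s N) x) (K g x) < e) sequentially"
    proof eventually_elim
      case (elim N)
      show ?case
      proof
        fix x assume x: "x \<in> sphere z r"
        note pf = T_pole_facts[OF t x]
        have "norm (chord_int (s N) (gegenbauer_weight l) (x, T_pole z t x) - chord_int g (gegenbauer_weight l) (x, T_pole z t x))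
            \<le> 2 * (e / (4 * M))"
          by (rule chord_int_diff_bound[OF convex_cball cs cg])
             (use elim x pf(3) in \<open>auto simp: dist_norm less_imp_le\<close>)
        moreover have "norm ((x - T_pole z t x) ^ l / (x - z - t)) \<le> M"
        proof -
          have "norm (x - T_pole z t x) \<le> 2 * r"
            using dist_triangle[of x "T_pole z t x" z] pf(3) x by (auto simp: dist_norm norm_minus_commute)
          then show ?thesis
            unfolding M_def norm_divide norm_power
            by (intro frac_le power_mono) (use pf(1) tr r in auto)
        qed
        ultimately have "norm ((x - T_pole z t x) ^ l / (x - z - t)) *
            norm (chord_int (s N) (gegenbauer_weight l) (x, T_pole z t x) - chord_int g (gegenbauer_weight l) (x, T_pole z t x))
            \<le> M * (2 * (e / (4 * M)))"
          using M by (intro mult_mono) auto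
        also have "\<dots> < e" using M e by simp
        finally show "dist (K (s N) x) (K g x) < e"
          by (simp add: dist_norm K_def right_diff_distrib diff_divide_distrib flip: norm_mult)
      qed
    qed
  qed
  have Ks: "(K (s N) has_contour_integral
      (\<Sum>n<N. a n * (2 * of_real pi * \<i> * (2 * 4 ^ l / (2 * of_nat l + of_nat n + 1) * t ^ l * 0 ^ n)))) (circlepath z r)" for N
  proof -
    have "((\<lambda>x. \<Sum>n<N. a n * K (\<lambda>w. (w - z) ^ n) x) has_contour_integral
      (\<Sum>n<N. a n * (2 * of_real pi * \<i> * (2 * 4 ^ l / (2 * of_nat l + of_nat n + 1) * t ^ l * 0 ^ n)))) (circlepath z r)"
      unfolding K_def by (intro has_contour_integral_sum has_contour_integral_lmul contour_integral_chord_monomial t) simp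
    moreover have "(\<Sum>n<N. a n * K (\<lambda>w. (w - z) ^ n) x) = K (s N) x" for x
    proof -
      have int: "(\<lambda>v. (chord_point (x, T_pole z t x) v - z) ^ n * gegenbauer_weight l v) integrable_on {-1..1}" for n
        by (rule chord_integrable[OF convex_UNIV, of "\<lambda>w. (w - z) ^ n"]) (auto intro!: continuous_intros continuous_on_gegenbauer_weight)
      have "chord_int (s N) (gegenbauer_weight l) (x, T_pole z t x)
        = integral {-1..1} (\<lambda>v. \<Sum>n<N. a n * ((chord_point (x, T_pole z t x) v - z) ^ n * gegenbauer_weight l v))"
        by (simp add: chord_int_def s_def sum_distrib_right mult.assoc)
      also have "\<dots> = (\<Sum>n<N. a n * chord_int (\<lambda>w. (w - z) ^ n) (gegenbauer_weight l) (x, T_pole z t x))"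
        unfolding chord_int_def using int by (subst integral_sum) (auto intro: integrable_on_mult_right)
      finally show ?thesis by (simp add: K_def sum_distrib_left sum_divide_distrib mult_ac)
    qed
    ultimately show ?thesis by (simp add: has_contour_integral_eq)
  qed
  have Kg: "(\<lambda>N. contour_integral (circlepath z r) (K (s N))) \<longlonglongrightarrow> contour_integral (circlepath z r) (K g)"
    using contour_integral_uniform_limit_circlepath(2)[OF _ ulim _ r] Ks
    by (simp add: has_contour_integral_integrable[OF Ks])
  \<comment> \<open>Only the term n = 0 contributes, so the integrals of the partial sums are
    constant from N = 1 on.\<close>
  have "eventually (\<lambda>N. contour_integral (circlepath z r) (K (s N)) =
     2 * of_real pi * \<i> * (2 * 4 ^ l / (2 * of_nat l + 1) * t ^ l * g z)) sequentially"
    using eventually_gt_at_top[of 0]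
  proof eventually_elim
    case (elim N)
    have "(\<Sum>n<N. a n * (2 * of_real pi * \<i> * (2 * 4 ^ l / (2 * of_nat l + of_nat n + 1) * t ^ l * 0 ^ n)))
      = (\<Sum>n\<in>{0}. a n * (2 * of_real pi * \<i> * (2 * 4 ^ l / (2 * of_nat l + of_nat n + 1) * t ^ l * 0 ^ n)))"
      by (rule sum.mono_neutral_right) (use elim in auto)
    then show ?case using contour_integral_unique[OF Ks[of N]] by (simp add: a_def)
  qed
  from LIMSEQ_unique[OF Kg tendsto_eventually[OF this]]
  have "contour_integral (circlepath z r) (K g) = 2 * of_real pi * \<i> * (2 * 4 ^ l / (2 * of_nat l + 1) * t ^ l * g z)" .
  then show ?thesis by (simp add: K_def[abs_def])
qed

section \<open>Admissible radii and evaluation of the contour operator\<close>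

lemma ball_subset_of_bdry_dist:
  assumes "z \<in> D" "ereal R \<le> bdry_dist D z"
  shows "ball z R \<subseteq> D"
proof
  fix w assume w: "w \<in> ball z R"
  show "w \<in> D"
  proof (rule ccontr)
    assume "w \<notin> D"
    \<comment> \<open>A segment leaving D meets the frontier no farther from z than its end point.
      This also covers D = \<complex>, where no such segment exists.\<close>
    then have "closed_segment z w \<inter> frontier D \<noteq> {}"
      using assms(1) by (intro connected_Int_frontier) auto
    then obtain u where u: "u \<in> closed_segment z w" "u \<in> frontier D" by auto
    have "bdry_dist D z \<le> ereal (dist z u)"
      unfolding bdry_dist_def by (rule INF_lower[OF u(2)])
    then have "ereal R \<le> ereal (dist z u)"
      using assms(2) by (rule order_trans[rotated])
    moreover have "dist z u \<le> dist z w"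
      using segment_bound1[OF u(1)] by (simp add: dist_norm norm_minus_commute)
    ultimately show False using w by simp
  qed
qed

lemma bdry_dist_pos:
  assumes "open D" "z \<in> D"
  obtains e where "e > 0" "ereal e \<le> bdry_dist D z"
proof -
  obtain e where e: "e > 0" "ball z e \<subseteq> D" using assms open_contains_ball by metis
  have "ereal e \<le> bdry_dist D z"
    unfolding bdry_dist_def
  proof (rule INF_greatest)
    fix w assume "w \<in> frontier D"
    then have "w \<notin> D" using assms(1) by (simp add: frontier_def interior_open)
    then show "ereal e \<le> ereal (dist z w)" using e(2) by (auto simp: not_less[symmetric])
  qed
  with e(1) show thesis by (rule that)
qed

text \<open>The value does not involve r, which is what the definite description in
  \<open>T_op\<close> requires.\<close>

lemma T_circ_Psi:
  assumes D: "open D" "convex D" and g: "g holomorphic_on D" and z: "z \<in> D"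
    and t: "2 * norm t < r" and r: "ereal r < bdry_dist D z"
  shows "T_circ r (Psi D l g) (z, t) = 2 * 4 ^ l / (2 * of_nat l + 1) * t ^ l * g z"
proof -
  obtain R where R: "r < R" "ereal R \<le> bdry_dist D z"
    using ereal_dense2[OF r] by (auto intro: less_imp_le)
  have sub: "ball z R \<subseteq> D" by (rule ball_subset_of_bdry_dist[OF z R(2)])
  then have sub': "cball z r \<subseteq> D" using R(1) by auto
  have rpos: "0 < r" using t norm_ge_zero[of t] by linarith
  have S: "open (D \<times> D)" using D by (simp add: open_Times)
  have Psi2: "Psi D l g holomorphic2_on (D \<times> D)"
    using Psi_in_Sol[OF D(2,1) g] by (simp add: Sol_def Hol2_def)
  have "T_circ r (Psi D l g) (z, t) = 1 / (2 * of_real pi * \<i>) *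
      contour_integral (circlepath z r) (\<lambda>x. Psi D l g (x, T_pole z t x) / (x - z - t))"
  proof (rule T_circ_eq_single_integral[OF t])
    fix x assume "x \<in> sphere z r"
    then have "x \<in> D" using sub' by auto
    then have "(\<lambda>y. Psi D l g (x, y)) holomorphic_on D"
      using holomorphic2_slice(2)[OF S Psi2, of x] by simp
    then show "(\<lambda>y. Psi D l g (x, y)) holomorphic_on cball z r"
      using sub' by (rule holomorphic_on_subset)
  qed
  also have "contour_integral (circlepath z r) (\<lambda>x. Psi D l g (x, T_pole z t x) / (x - z - t)) =
    contour_integral (circlepath z r)
      (\<lambda>x. (x - T_pole z t x) ^ l * chord_int g (gegenbauer_weight l) (x, T_pole z t x) / (x - z - t))"
  proof (rule contour_integral_eq)
    fix x assume "x \<in> path_image (circlepath z r)"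
    then have x: "x \<in> sphere z r" using rpos by simp
    then have "(x, T_pole z t x) \<in> D \<times> D" using sub' T_pole_facts(3)[OF t x] by auto
    then show "Psi D l g (x, T_pole z t x) / (x - z - t) =
      (x - T_pole z t x) ^ l * chord_int g (gegenbauer_weight l) (x, T_pole z t x) / (x - z - t)"
      by (simp only: Psi_eq split)
  qed
  also have "\<dots> = 2 * of_real pi * \<i> * (2 * 4 ^ l / (2 * of_nat l + 1) * t ^ l * g z)"
    by (rule contour_integral_chord[OF t R(1) holomorphic_on_subset[OF g sub]])
  finally show ?thesis by simp
qed

lemma T_op_Psi:
  assumes D: "open D" "convex D" and g: "g holomorphic_on D" and zt: "(z, t) \<in> U_dom D"
  shows "T_op D (Psi D l g) (z, t) = t ^ l * (2 ^ (2 * l + 1) / (2 * of_nat l + 1) * g z)"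
proof -
  have z: "z \<in> D" and t: "ereal (2 * norm t) < bdry_dist D z" using zt by (auto simp: U_dom_def)
  \<comment> \<open>At least one admissible radius must exist, for otherwise every c would satisfy
    the description vacuously.\<close>
  obtain r where r: "2 * norm t < r" "ereal r < bdry_dist D z" using ereal_dense2[OF t] by auto
  have "T_op D (Psi D l g) (z, t) = 2 * 4 ^ l / (2 * of_nat l + 1) * t ^ l * g z"
    unfolding T_op_def split
    by (rule the_equality) (use T_circ_Psi[OF D g z] r in \<open>force+\<close>)
  moreover have "2 ^ (2 * l + 1) = (2 * 4 ^ l :: complex)"
    by (simp add: power_mult)
  ultimately show ?thesis by (simp add: mult_ac)
qed

lemma tT_Psi:
  assumes D: "open D" "convex D" and g: "g \<in> Hol D"
  shows "tT D l (Psi D l g) = (\<lambda>z\<in>D. 2 ^ (2 * l + 1) / (2 * of_nat l + 1) * g z)" (is "_ = ?\<phi>")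
  unfolding tT_def
proof (rule the_equality)
  have gh: "g holomorphic_on D" using g by (simp add: Hol_def)
  have "(\<lambda>z. 2 ^ (2 * l + 1) / (2 * of_nat l + 1) * g z) holomorphic_on D"
    by (intro holomorphic_on_mult holomorphic_on_const gh)
  then have "?\<phi> holomorphic_on D" by (rule holomorphic_transform) simp
  then show "?\<phi> \<in> Hol D \<and> (\<forall>(z, t)\<in>U_dom D. T_op D (Psi D l g) (z, t) = t ^ l * ?\<phi> z)"
    using T_op_Psi[OF D gh] by (auto simp: Hol_def U_dom_def)
  fix \<phi> assume \<phi>: "\<phi> \<in> Hol D \<and> (\<forall>(z, t)\<in>U_dom D. T_op D (Psi D l g) (z, t) = t ^ l * \<phi> z)"
  show "\<phi> = ?\<phi>"
  proof
    fix z
    show "\<phi> z = ?\<phi> z"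
    proof (cases "z \<in> D")
      case True
      obtain e where e: "e > 0" "ereal e \<le> bdry_dist D z" using bdry_dist_pos[OF D(1) True] .
      \<comment> \<open>A nonzero t lets t^l be cancelled, and 2|t| = e/2 < e keeps (z, t) in the
        domain.\<close>
      define t :: complex where "t = of_real (e / 4)"
      have "ereal (2 * norm t) < ereal e" using e(1) by (simp add: t_def)
      from less_le_trans[OF this e(2)] have zt: "(z, t) \<in> U_dom D" using True by (simp add: U_dom_def)
      have "t ^ l * \<phi> z = t ^ l * (2 ^ (2 * l + 1) / (2 * of_nat l + 1) * g z)"
        using \<phi> zt T_op_Psi[OF D gh zt, of l] by auto
      then have "\<phi> z = 2 ^ (2 * l + 1) / (2 * of_nat l + 1) * g z"
        by (subst (asm) mult_cancel_left) (use e(1) in \<open>simp add: t_def\<close>)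
      with True show ?thesis by simp
    next
      case False
      have "\<phi> \<in> extensional D" using \<phi> by (simp add: Hol_def)
      from extensional_arb[OF this False] False show ?thesis by simp
    qed
  qed
qed

theorem theorem4p1:
  fixes D :: "complex set" and l :: nat
  assumes "open D" and "D \<noteq> {}" and "convex D"
  shows "bij_betw (tT D l) (Sol D l) (Hol D) \<and>
    bij_betw (Psi D l) (Hol D) (Sol D l) \<and>
    (\<forall>g \<in> Hol D. tT D l (Psi D l g) = (\<lambda>z\<in>D. 2 ^ (2 * l + 1) / (2 * of_nat l + 1) * g z))"
proof -
  note D = assms(1,3)
  define c :: complex where "c = 2 ^ (2 * l + 1) / (2 * of_nat l + 1)"
  have "of_nat (2 * l + 1) \<noteq> (0 :: complex)" by (simp only: of_nat_eq_0_iff)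
  then have c: "c \<noteq> 0" by (simp add: c_def add.commute)
  have tT: "tT D l (Psi D l g) = (\<lambda>z\<in>D. c * g z)" if "g \<in> Hol D" for g
    unfolding c_def by (rule tT_Psi[OF D that])
  have scale_Hol: "(\<lambda>z\<in>D. a * g z) \<in> Hol D" if "g \<in> Hol D" for a g
  proof -
    have "(\<lambda>z. a * g z) holomorphic_on D" using that by (auto simp: Hol_def intro: holomorphic_intros)
    then have "(\<lambda>z\<in>D. a * g z) holomorphic_on D" by (rule holomorphic_transform) simp
    then show ?thesis by (simp add: Hol_def)
  qed
  have unscale: "(\<lambda>z\<in>D. a * (\<lambda>z\<in>D. b * g z) z) = g" if "g \<in> Hol D" "a * b = 1" for a b g
  proof
    fix z show "(\<lambda>z\<in>D. a * (\<lambda>z\<in>D. b * g z) z) z = g z"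
      using that extensional_arb[of g D z] mult.assoc[of a b "g z"] by (cases "z \<in> D") (auto simp: Hol_def)
  qed
  have scale: "bij_betw (\<lambda>g. \<lambda>z\<in>D. c * g z) (Hol D) (Hol D)"
  proof (rule bij_betw_byWitness[where f' = "\<lambda>g. \<lambda>z\<in>D. (1 / c) * g z"])
    show "\<forall>g\<in>Hol D. (\<lambda>z\<in>D. (1 / c) * (\<lambda>z\<in>D. c * g z) z) = g"
      and "\<forall>g\<in>Hol D. (\<lambda>z\<in>D. c * (\<lambda>z\<in>D. (1 / c) * g z) z) = g"
      by (intro ballI unscale; simp add: c)+
  qed (use scale_Hol in blast)+
  \<comment> \<open>Bijectivity of the composite makes \<open>Psi\<close> injective; with
    surjectivity \<open>Psi\<close> is bijective, and \<open>tT\<close> inherits bijectivity from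
    the composite.\<close>
  have comp: "bij_betw (tT D l \<circ> Psi D l) (Hol D) (Hol D)"
    by (subst bij_betw_cong[where g = "\<lambda>g. \<lambda>z\<in>D. c * g z"]) (use scale tT in auto)
  have "inj_on (Psi D l) (Hol D)"
    using inj_on_imageI2[OF bij_betw_imp_inj_on[OF comp]] .
  moreover have "Psi D l ` Hol D = Sol D l"
    using Psi_in_Sol[OF D(2,1)] Sol_imp_Psi[OF D(2,1)] unfolding Hol_def by blast
  ultimately have Psi: "bij_betw (Psi D l) (Hol D) (Sol D l)" by (simp add: bij_betw_def)
  then have "bij_betw (tT D l) (Sol D l) (Hol D)"
    using comp bij_betw_comp_iff by blast
  with Psi tT show ?thesis by (auto simp: c_def)
qed

end
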